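(* For all $\rho,\beta>0$ the radius of starlikeness $r^{\star}(h_{\rho,\beta})$ satisfies $$\frac{\Gamma(\rho+\beta)}{2\Gamma(\beta)}<r^\star(h_{\rho,\beta})<\frac{2\Gamma(\rho+\beta)\Gamma(2\rho+\beta)}{\Delta_{4,3}(\rho,\beta)}$$ and $$\sqrt{\frac{\Gamma^{2}(\rho+\beta)\Gamma(2\rho+\beta)}{\Gamma(\beta)\Delta_{4,3}(\rho,\beta)}}<r^\star(h_{\rho,\beta})<\frac{\Gamma(\rho+\beta)\Gamma(3\rho+\beta)\Delta_{4,3}(\rho,\beta)}{\Gamma(\beta)\Gamma(3\rho+\beta)\Delta_{8,9}(\rho,\beta)+2\Gamma^{3}(\rho+\beta)\Gamma(2\rho+\beta)}.$$
   Context: The Wright function is the entire function (of $z$) $\phi(\rho,\beta,z)=\sum_{n\ge 0}\frac{z^n}{n!\,\Gamma(n\rho+\beta)}$, and $h_{\rho,\beta}(z)=z\,\Gamma(\beta)\phi(\rho,\beta,-z)$. Notation: $\Delta_{a,b}(\rho,\beta)=a\,\Gamma(\beta)\Gamma(2\rho+\beta)-b\,\Gamma^2(\rho+\beta)$, and $\Gamma^k(x)=(\Gamma(x))^k$. For $r>0$ let $\mathbb{D}_r=\{z\in\mathbb{C}:|z|<r\}$. For an analytic $f$ normalized by $f(0)=f'(0)-1=0$, the radius of starlikeness (of order $0$) is $r^{\star}(f)=\sup\{r>0:\ \operatorname{Re}(zf'(z)/f(z))>0\ \text{for all } z\in\mathbb{D}_r\}$ (the quotient has value $1$ at $z=0$).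 *)

theory Defs
  imports "HOL-Complex_Analysis.Complex_Analysis"
begin

definition wright :: "real \<Rightarrow> real \<Rightarrow> complex \<Rightarrow> complex" where
  "wright \<rho> \<beta> z = (\<Sum>n. z ^ n / (fact n * of_real (Gamma (real n * \<rho> + \<beta>))))"

definition wright_h :: "real \<Rightarrow> real \<Rightarrow> complex \<Rightarrow> complex" where
  "wright_h \<rho> \<beta> z = z * of_real (Gamma \<beta>) * wright \<rho> \<beta> (- z)"

definition Gamma_Delta :: "real \<Rightarrow> real \<Rightarrow> real \<Rightarrow> real \<Rightarrow> real" where
  "Gamma_Delta a b \<rho> \<beta> = a * Gamma \<beta> * Gamma (2 * \<rho> + \<beta>) - b * (Gamma (\<rho> + \<beta>))\<^sup>2"

(* The quotient z f'(z) / f(z), continued by 1 at the origin, where f(0) = 0 and f'(0) = 1.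
   At a zero z of f other than the origin the quotient has a pole; there the HOL value is 0,
   so the condition Re > 0 fails, as it should. *)
definition starlike_quot :: "(complex \<Rightarrow> complex) \<Rightarrow> complex \<Rightarrow> complex" where
  "starlike_quot f z = (if z = 0 then 1 else z * deriv f z / f z)"

(* The supremum is taken in the extended reals, since it may be infinite for a general f. *)
definition radius_of_starlikeness :: "(complex \<Rightarrow> complex) \<Rightarrow> ereal" where
  "radius_of_starlikeness f =
     Sup {ereal r | r. r > 0 \<and> (\<forall>z\<in>ball 0 r. Re (starlike_quot f z) > 0)}"

end

theory Submission
  imports Defs "HOL-Real_Asymp.Real_Asymp"
begin

unbundle no vec_syntax

text \<open>
  Put \<open>h(z) = z \<lambda>(z)\<close>. By Gauss's product for Gamma, \<open>\<lambda>\<close> is the locally uniform limit of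
  the functions obtained from \<open>e^{-z}\<close> by applying the operators \<open>\<rho> z d/dz + \<beta> + j\<close> and rescaling
  \<open>z\<close>. By Rolle's theorem each such operator keeps the form ``\<open>e^{-a z}\<close> times a polynomial with
  simple positive zeros'', and so does \<open>f \<mapsto> (z f)'\<close>. Hence both \<open>\<lambda>\<close> and \<open>h'\<close> are limits of such
  functions. For the approximants, \<open>Re (z h'(z) / h(z))\<close> on \<open>|z| = r\<close> is smallest at \<open>z = r\<close>, so
  the radius of starlikeness is the least positive zero \<open>\<tau>\<close> of \<open>h'\<close>.

  Let \<open>\<sigma>_k\<close> be the Taylor coefficients of \<open>- h'' / h'\<close>, that is, the power sums of the reciprocal
  zeros. Passing to the limit gives the Euler-Rayleigh inequalities \<open>\<sigma>_k \<tau>^k \<ge> 1\<close> and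
  \<open>\<sigma>_{k+1} \<tau> \<le> \<sigma>_k\<close> without any factorisation theorem for \<open>h'\<close>. If one of the strict versions failed,
  then Cauchy-Schwarz would make \<open>\<sigma>_k\<close> geometric for \<open>k \<ge> 2\<close>, and \<open>h'\<close> would satisfy a first-order
  differential equation that contradicts the superexponential growth of Gamma.
\<close>

unbundle no vec_syntax

section \<open>Exponentials times polynomials with positive zeros\<close>

text \<open>The elements of \<open>X\<close> are the reciprocals of the zeros.\<close>
definition lp_fps :: "real \<Rightarrow> real set \<Rightarrow> real fps" where
  "lp_fps a X = fps_exp (- a) * (\<Prod>x\<in>X. 1 - fps_const x * fps_X)"

lemma lp_fps_insert:
  assumes "finite X" "x \<notin> X"
  shows "lp_fps a (insert x X) = lp_fps a X * (1 - fps_const x * fps_X)"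
  using assms by (simp add: lp_fps_def mult_ac)

lemma lp_fps_nth_0: "finite X \<Longrightarrow> lp_fps a X $ 0 = 1"
  by (induction X rule: finite_induct) (simp_all add: lp_fps_insert, simp add: lp_fps_def)

lemma lp_fps_sums:
  fixes z :: "'a :: {real_normed_field,banach}"
  assumes "finite X"
  shows "(\<lambda>n. of_real (lp_fps a X $ n) * z ^ n) sums
           (exp (- of_real a * z) * (\<Prod>x\<in>X. 1 - of_real x * z))"
  using assms
proof (induction X rule: finite_induct)
  case empty
  have "(\<lambda>n. (- of_real a * z) ^ n /\<^sub>R fact n) sums exp (- of_real a * z)"
    by (rule exp_converges)
  moreover have "(- of_real a * z) ^ n /\<^sub>R fact n = of_real (lp_fps a {} $ n) * z ^ n" for n
    by (simp add: lp_fps_def scaleR_conv_of_real divide_simps flip: power_mult_distrib)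
  ultimately show ?case by simp
next
  case (insert x X)
  let ?F = "lp_fps a X" and ?s = "exp (- of_real a * z) * (\<Prod>x\<in>X. 1 - of_real x * z)"
  define f where "f n = of_real (if n = 0 then 0 else ?F $ (n - 1)) * z ^ n" for n
  have "(\<lambda>n. f (Suc n)) sums (z * ?s)"
    using sums_mult[OF insert.IH, of z] by (simp add: f_def mult_ac)
  hence "f sums (z * ?s)"
    by (subst (asm) sums_Suc_iff) (simp add: f_def)
  hence "(\<lambda>n. of_real (?F $ n) * z ^ n - of_real x * f n) sums (?s - of_real x * (z * ?s))"
    by (intro sums_diff insert.IH sums_mult)
  moreover have "of_real (?F $ n) * z ^ n - of_real x * f n =
      of_real (lp_fps a (insert x X) $ n) * z ^ n" for n
  proof -
    have "lp_fps a (insert x X) = ?F - fps_const x * (?F * fps_X)"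
      using insert.hyps by (simp add: lp_fps_insert algebra_simps)
    hence "lp_fps a (insert x X) $ n = ?F $ n - x * (?F * fps_X) $ n"
      by simp
    also have "\<dots> = ?F $ n - x * (if n = 0 then 0 else ?F $ (n - 1))"
      by simp
    finally have E: "lp_fps a (insert x X) $ n = \<dots>" .
    show ?thesis unfolding E f_def by (simp add: algebra_simps)
  qed
  ultimately show ?case
    using insert.hyps by (simp add: algebra_simps)
qed

text \<open>Logarithmic differentiation: each linear factor contributes x / (1 - x z), whose
  geometric series supplies the power sums. The exponential contributes only a constant, hence the
  extra a at k = 0.\<close>

lemma fps_deriv_lp_fps:
  assumes "finite X"
  shows "fps_deriv (lp_fps a X) =
           - (lp_fps a X * Abs_fps (\<lambda>k. (\<Sum>x\<in>X. x ^ Suc k) + (if k = 0 then a else 0)))"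
    (is "_ = - (_ * ?S X)")
  using assms
proof (induction X rule: finite_induct)
  case empty
  have "?S {} = fps_const a" by (rule fps_ext) simp
  moreover have "fps_deriv (lp_fps a {}) = - (lp_fps a {} * fps_const a)"
    by (rule fps_ext) (simp add: lp_fps_def flip: fps_const_neg)
  ultimately show ?case by simp
next
  case (insert x X)
  let ?g = "Abs_fps (\<lambda>k. x ^ Suc k)"
  have S: "?S (insert x X) = ?S X + ?g"
    using insert.hyps by (intro fps_ext) simp
  have g: "(1 - fps_const x * fps_X) * ?g = fps_const x"
  proof (rule fps_ext)
    fix n show "((1 - fps_const x * fps_X) * ?g) $ n = fps_const x $ n"
      by (cases n) (simp_all add: ring_distribs mult.assoc)
  qed
  have "fps_deriv (lp_fps a (insert x X)) =
      - (lp_fps a X * ?S X) * (1 - fps_const x * fps_X) - lp_fps a X * fps_const x"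
    using insert by (simp add: lp_fps_insert flip: fps_const_neg)
  also have "\<dots> = - (lp_fps a X * ?S X) * (1 - fps_const x * fps_X) -
      lp_fps a X * ((1 - fps_const x * fps_X) * ?g)"
    by (simp only: g)
  also have "\<dots> = - (lp_fps a X * (1 - fps_const x * fps_X) * (?S X + ?g))"
    by (simp add: algebra_simps)
  finally show ?case by (simp only: S lp_fps_insert[OF insert.hyps])
qed

lemma lp_fps_scale:
  assumes "finite X" "s \<noteq> 0"
  shows "Abs_fps (\<lambda>n. s ^ n * lp_fps a X $ n) = lp_fps (s * a) ((*) s ` X)"
proof -
  have "Abs_fps (\<lambda>n. s ^ n * lp_fps a X $ n) = lp_fps a X oo (fps_const s * fps_X)"
    by (simp add: fps_compose_linear)
  also have "\<dots> = (fps_exp (- a) oo (fps_const s * fps_X)) *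
       (\<Prod>x\<in>X. (1 - fps_const x * fps_X) oo (fps_const s * fps_X))"
    unfolding lp_fps_def by (subst fps_compose_mult_distrib) (simp_all add: fps_compose_prod_distrib)
  also have "fps_exp (- a) oo (fps_const s * fps_X) = fps_exp (- (s * a))"
    by (rule fps_ext) (simp add: fps_compose_linear power_mult_distrib power_minus')
  also have "(\<Prod>x\<in>X. (1 - fps_const x * fps_X) oo (fps_const s * fps_X)) =
      (\<Prod>x\<in>X. 1 - fps_const (s * x) * fps_X)"
    by (simp add: fps_compose_sub_distrib fps_compose_mult_distrib mult_ac flip: fps_const_mult)
  also have "(\<Prod>x\<in>X. 1 - fps_const (s * x) * fps_X) = (\<Prod>x\<in>(*) s ` X. 1 - fps_const x * fps_X)"
    using assms by (subst prod.reindex) (auto simp: inj_on_def)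
  finally show ?thesis by (simp add: lp_fps_def)
qed

section \<open>Rolle's theorem on the half-line and preservation of positive zeros\<close>

lemma rolle_at_top:
  fixes u u' :: "real \<Rightarrow> real"
  assumes cont: "continuous_on {t..} u"
    and deriv: "\<And>x. x > t \<Longrightarrow> (u has_real_derivative u' x) (at x)"
    and "u t = 0" and lim: "(u \<longlongrightarrow> 0) at_top"
  shows "\<exists>s>t. u' s = 0"
proof -
  have R: "\<exists>s>c. s < d \<and> u' s = 0" if "t \<le> c" "c < d" "u c = u d" for c d
  proof -
    have "\<exists>s>c. s < d \<and> (\<lambda>h. h * u' s) = (\<lambda>v. 0)"
    proof (rule Rolle_deriv[OF that(2,3)])
      show "continuous_on {c..d} u" using that by (intro continuous_on_subset[OF cont]) auto
      show "(u has_derivative (\<lambda>h. h * u' x)) (at x)" if "c < x" "x < d" for x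
        using deriv[of x] that \<open>t \<le> c\<close> by (simp add: has_field_derivative_def mult_commute_abs)
    qed
    thus ?thesis by (metis mult_1)
  qed
  show ?thesis
  proof (cases "u (t + 1) = 0")
    case True
    thus ?thesis using R[of t "t + 1"] assms(3) by force
  next
    case False
    define v where "v x = u x * sgn (u (t + 1))" for x
    have v1: "v (t + 1) > 0" using False by (simp add: v_def mult_less_0_iff zero_less_mult_iff sgn_if)
    have contv: "continuous_on {t..} v" unfolding v_def by (intro continuous_intros cont)
    have "((\<lambda>x. u x * sgn (u (t + 1))) \<longlongrightarrow> 0 * sgn (u (t + 1))) at_top" by (intro tendsto_intros lim)
    hence "(v \<longlongrightarrow> 0) at_top" by (simp add: v_def[abs_def])
    hence "eventually (\<lambda>x. v x < v (t + 1)) at_top"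
      using v1 by (rule order_tendstoD(2))
    hence "eventually (\<lambda>x. v x < v (t + 1) \<and> x > t + 1) at_top"
      using eventually_gt_at_top eventually_conj by blast
    then obtain y where y: "v y < v (t + 1)" "y > t + 1"
      by (auto simp: eventually_at_top_linorder)
    \<comment> \<open>Either \<open>v\<close> vanishes again beyond t + 1, and that zero pairs with
      t, or \<open>v y\<close> lies strictly between \<open>v t = 0\<close> and
      \<open>v (t + 1)\<close> and is therefore also taken between t and t + 1.\<close>
    have "\<exists>c d. t \<le> c \<and> c < d \<and> u c = u d"
    proof (cases "v y \<le> 0")
      case True
      have "\<exists>x\<ge>t+1. x \<le> y \<and> v x = 0"
        using True v1 y by (intro IVT2' continuous_on_subset[OF contv]) auto
      then obtain d where "d \<ge> t + 1" "v d = 0" by blast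
      hence "u d = 0" using False by (simp add: v_def sgn_zero_iff)
      thus ?thesis using assms(3) \<open>d \<ge> t + 1\<close> by (intro exI[of _ t] exI[of _ d]) auto
    next
      case vy: False
      have "\<exists>x\<ge>t. x \<le> t + 1 \<and> v x = v y"
        using vy y assms(3) by (intro IVT' continuous_on_subset[OF contv]) (auto simp: v_def)
      then obtain c where "c \<ge> t" "c \<le> t + 1" "v c = v y" by blast
      thus ?thesis using y False by (intro exI[of _ c] exI[of _ y]) (auto simp: v_def sgn_if split: if_splits)
    qed
    then obtain c d where "t \<le> c" "c < d" "u c = u d" by blast
    from R[OF this] show ?thesis using \<open>t \<le> c\<close> by force
  qed
qed

text \<open>The points of T together with 0 bound \<open>card T + 1\<close> gaps, the last one
  reaching to infinity. Each gap contains a zero of \<open>u'\<close>, and zeros from different gaps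
  are distinct.\<close>

lemma rolle_card:
  fixes u u' :: "real \<Rightarrow> real"
  assumes cont: "continuous_on {0..} u"
    and deriv: "\<And>x. x > 0 \<Longrightarrow> (u has_real_derivative u' x) (at x)"
    and "u 0 = 0" and lim: "(u \<longlongrightarrow> 0) at_top"
    and T: "finite T" "\<And>t. t \<in> T \<Longrightarrow> t > 0" "\<And>t. t \<in> T \<Longrightarrow> u t = 0"
  shows "\<exists>T'. finite T' \<and> card T' = Suc (card T) \<and> (\<forall>s\<in>T'. s > 0 \<and> u' s = 0)"
proof -
  let ?T = "insert 0 T"
  have "\<exists>s>t. u' s = 0 \<and> (\<forall>t'\<in>T. t < t' \<longrightarrow> s < t')" if t: "t \<in> ?T" for t
  proof (cases "\<exists>t'\<in>T. t < t'")
    case True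
    define m where "m = Min {t'\<in>T. t < t'}"
    have "m \<in> {t'\<in>T. t < t'}" unfolding m_def using True T by (intro Min_in) auto
    hence m: "m \<in> T" "t < m" by auto
    have mle: "m \<le> t'" if "t' \<in> T" "t < t'" for t'
      unfolding m_def using that T by (intro Min_le) auto
    have t0: "t \<ge> 0" using t T(2) by force
    have "\<exists>s>t. s < m \<and> (\<lambda>h. h * u' s) = (\<lambda>v. 0)"
    proof (rule Rolle_deriv[OF m(2)])
      show "u t = u m" using t m assms by auto
      show "continuous_on {t..m} u" using t0 by (intro continuous_on_subset[OF cont]) auto
      show "(u has_derivative (\<lambda>h. h * u' x)) (at x)" if "t < x" "x < m" for x
        using deriv[of x] that t0 by (simp add: has_field_derivative_def mult_commute_abs)
    qed
    then obtain s where "s > t" "s < m" "u' s = 0" by (metis mult_1)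
    thus ?thesis using mle by force
  next
    case False
    have "t \<ge> 0" "u t = 0" using t T assms(3) by force+
    hence "\<exists>s>t. u' s = 0"
      using cont deriv lim by (intro rolle_at_top) (auto intro: continuous_on_subset)
    thus ?thesis using False by blast
  qed
  then obtain s where s: "\<And>t. t \<in> ?T \<Longrightarrow> s t > t \<and> u' (s t) = 0 \<and> (\<forall>t'\<in>T. t < t' \<longrightarrow> s t < t')"
    by metis
  have less: "s t < s t'" if "t \<in> ?T" "t' \<in> ?T" "t < t'" for t t'
  proof -
    have "t' \<in> T" using that T(2)[of t] by auto
    thus ?thesis using s[OF that(1)] s[OF that(2)] that(3) by force
  qed
  have "inj_on s ?T"
    by (rule inj_onI) (metis less less_irrefl linorder_less_linear)
  moreover have "0 \<notin> T" using T(2) by blast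
  ultimately have "card (s ` ?T) = Suc (card T)" using T(1) by (simp add: card_image)
  moreover have "s t > 0" if "t \<in> ?T" for t
    using s[OF that] that T(2)[of t] by auto
  ultimately show ?thesis
    using s T(1) by (intro exI[of _ "s ` ?T"]) auto
qed

text \<open>The exponent k is left arbitrary in the induction because the factor 1 - y t splits the
  expression into terms with exponents k and k + 1.\<close>

lemma powr_exp_prod_tendsto_0:
  fixes a k :: real
  assumes "finite X" "a > 0"
  shows "((\<lambda>t. t powr k * exp (- a * t) * (\<Prod>x\<in>X. 1 - x * t)) \<longlongrightarrow> 0) at_top"
  using assms(1)
proof (induction X arbitrary: k rule: finite_induct)
  case empty
  show ?case using assms(2) by simp real_asymp
next
  case (insert y X)
  have "((\<lambda>t. t powr k * exp (- a * t) * (\<Prod>x\<in>X. 1 - x * t) -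
      y * (t powr (k + 1) * exp (- a * t) * (\<Prod>x\<in>X. 1 - x * t))) \<longlongrightarrow> 0 - y * 0) at_top"
    by (intro tendsto_intros insert.IH)
  moreover have "eventually (\<lambda>t. t powr k * exp (- a * t) * (\<Prod>x\<in>X. 1 - x * t) -
      y * (t powr (k + 1) * exp (- a * t) * (\<Prod>x\<in>X. 1 - x * t)) =
      t powr k * exp (- a * t) * (\<Prod>x\<in>insert y X. 1 - x * t)) at_top"
    using eventually_gt_at_top[of 0]
    by eventually_elim (use insert.hyps in \<open>simp add: powr_add algebra_simps\<close>)
  ultimately show ?case by (simp add: filterlim_cong)
qed

text \<open>Roots are divided out one at a time. They are nonzero, so each factor can be normalised
  to 1 at the origin, which leaves p(0) as the constant.\<close>

lemma poly_eq_prod_roots: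
  fixes p :: "real poly"
  assumes "finite T" "\<And>t. t \<in> T \<Longrightarrow> poly p t = 0" "degree p \<le> card T" "0 \<notin> T"
  shows "p = smult (poly p 0) (\<Prod>t\<in>T. [:1, - inverse t:])"
  using assms
proof (induction T arbitrary: p rule: finite_induct)
  case empty
  thus ?case by (auto elim!: degree_eq_zeroE)
next
  case (insert t T)
  have "poly p t = 0" using insert.prems by simp
  then obtain q where q: "p = [:- t, 1:] * q" by (auto simp: poly_eq_0_iff_dvd)
  show ?case
  proof (cases "q = 0")
    case False
    have "degree p = Suc (degree q)" unfolding q using False by (subst degree_mult_eq) auto
    moreover have "poly q s = 0" if "s \<in> T" for s
      using insert.prems(1)[of s] that insert.hyps by (auto simp: q)
    ultimately have "q = smult (poly q 0) (\<Prod>t\<in>T. [:1, - inverse t:])"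
      using insert.prems insert.hyps by (intro insert.IH) auto
    hence "p = [:- t, 1:] * smult (poly q 0) (\<Prod>t\<in>T. [:1, - inverse t:])" using q by simp
    also have "[:- t, 1:] = smult (- t) [:1, - inverse t:]"
      using insert.prems by auto
    also have "smult (- t) [:1, - inverse t:] * smult (poly q 0) (\<Prod>t\<in>T. [:1, - inverse t:]) =
        smult (- t * poly q 0) (\<Prod>t\<in>insert t T. [:1, - inverse t:])"
      unfolding prod.insert[OF insert.hyps] mult_smult_left mult_smult_right smult_smult
      by (simp only: mult.commute)
    also have "- t * poly q 0 = poly p 0" by (simp add: q)
    finally show ?thesis .
  qed (simp add: q)
qed

text \<open>
  The new polynomial factor is, up to a positive function, the derivative of
  \<open>t powr (b / c) * exp (- a * t) * Q t\<close>, which vanishes at \<open>0\<close>, at the zeros of \<open>Q\<close> and at infinity.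
\<close>
lemma lp_fps_step:
  fixes a b c :: real
  assumes X: "finite X" "\<And>x. x \<in> X \<Longrightarrow> x > 0" and "a > 0" "b > 0" "c > 0"
  shows "\<exists>Y. finite Y \<and> (\<forall>y\<in>Y. y > 0) \<and>
           Abs_fps (\<lambda>n. (c * real n + b) / b * lp_fps a X $ n) = lp_fps a Y"
proof -
  define Q where "Q = (\<Prod>x\<in>X. [:1, - x:])"
  \<comment> \<open>Chosen so that the operator c z d/dz + b maps exp (- a z) Q to exp (- a z)
    P.\<close>
  define P where "P = [:0, c:] * (pderiv Q - smult a Q) + smult b Q"
  have Q: "fps_of_poly Q = (\<Prod>x\<in>X. 1 - fps_const x * fps_X)"
    by (simp add: Q_def fps_of_poly_prod fps_of_poly_pCons flip: fps_const_neg)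
  have lp: "lp_fps a X = fps_exp (- a) * fps_of_poly Q" by (simp add: lp_fps_def Q)
  have P: "fps_exp (- a) * fps_of_poly P =
      fps_const c * fps_X * fps_deriv (lp_fps a X) + fps_const b * lp_fps a X"
    unfolding lp P_def
    by (simp add: fps_of_poly_add fps_of_poly_diff fps_of_poly_mult fps_of_poly_smult
        fps_of_poly_pCons fps_of_poly_pderiv algebra_simps flip: fps_const_neg)
  have degQ: "degree Q \<le> card X"
    unfolding Q_def using degree_prod_sum_le[OF X(1), of "\<lambda>x. [:1, - x:]"] X
    by (intro order.trans[OF degree_prod_sum_le[OF X(1)]] order.trans[OF sum_bounded_above[of X _ 1]]) auto
  \<comment> \<open>This bound equals the number of positive zeros that Rolle's theorem will supply,
    so they are all the zeros of P.\<close>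
  have degP: "degree P \<le> Suc (card X)"
  proof -
    have "degree (pderiv Q - smult a Q) \<le> card X"
      using degQ degree_pderiv[of Q] by (intro degree_diff_le) auto
    hence "degree ([:0, c:] * (pderiv Q - smult a Q)) \<le> Suc (card X)"
      by (intro order.trans[OF degree_mult_le]) auto
    thus ?thesis unfolding P_def using degQ by (intro degree_add_le) auto
  qed
  have poly_Q: "poly Q t = (\<Prod>x\<in>X. 1 - x * t)" for t
    by (simp add: Q_def poly_prod mult_ac)
  have P0: "poly P 0 = b" by (simp add: P_def poly_Q)
  define T where "T = inverse ` X"
  have T: "finite T" "card T = card X" "\<And>t. t \<in> T \<Longrightarrow> t > 0" "\<And>t. t \<in> T \<Longrightarrow> poly Q t = 0"
  proof -
    show "card T = card X" unfolding T_def by (intro card_image) (auto simp: inj_on_def)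
    show "poly Q t = 0" if "t \<in> T" for t
      using that X unfolding T_def poly_Q by (force simp: prod_zero_iff)
  qed (use X in \<open>auto simp: T_def\<close>)
  define u where "u t = t powr (b / c) * exp (- a * t) * poly Q t" for t
  define u' where "u' t = t powr (b / c - 1) * exp (- a * t) / c * poly P t" for t
  have "\<exists>T'. finite T' \<and> card T' = Suc (card T) \<and> (\<forall>s\<in>T'. s > 0 \<and> u' s = 0)"
  proof (rule rolle_card)
    show "(u has_real_derivative u' t) (at t)" if "t > 0" for t
    proof -
      have "(u has_real_derivative ((b / c) * t powr (b / c - 1) * exp (- a * t) * poly Q t +
          t powr (b / c) * (exp (- a * t) * (- a)) * poly Q t +
          t powr (b / c) * exp (- a * t) * poly (pderiv Q) t)) (at t)"
        unfolding u_def using that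
        by (auto intro!: derivative_eq_intros simp: algebra_simps)
      also have "t powr (b / c) = t * t powr (b / c - 1)"
        using that by (simp add: powr_diff)
      finally show ?thesis using \<open>c > 0\<close> by (simp add: u'_def P_def field_simps)
    qed
    show "continuous_on {0..} u" unfolding u_def using \<open>b > 0\<close> \<open>c > 0\<close>
      by (intro continuous_intros continuous_on_powr') auto
    show "u 0 = 0" by (simp add: u_def)
    show "(u \<longlongrightarrow> 0) at_top"
      unfolding u_def poly_Q by (intro powr_exp_prod_tendsto_0 X \<open>a > 0\<close>)
    show "u t = 0" if "t \<in> T" for t using T(4)[OF that] by (simp add: u_def)
  qed (use T in auto)
  then obtain S where S: "finite S" "card S = Suc (card T)" "\<And>s. s \<in> S \<Longrightarrow> s > 0 \<and> u' s = 0"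
    by blast
  have PS: "poly P s = 0" if "s \<in> S" for s
    using S(3)[OF that] \<open>c > 0\<close> by (auto simp: u'_def)
  have "P = smult (poly P 0) (\<Prod>s\<in>S. [:1, - inverse s:])"
    using S degP T(2) PS by (intro poly_eq_prod_roots) auto
  hence "P = smult b (\<Prod>s\<in>S. [:1, - inverse s:])" by (simp only: P0)
  moreover have "(\<Prod>s\<in>S. [:1, - inverse s:]) = (\<Prod>y\<in>inverse ` S. [:1, - y:])"
    by (subst prod.reindex) (auto simp: inj_on_def)
  ultimately have "P = smult b (\<Prod>y\<in>inverse ` S. [:1, - y:])" by simp
  hence "fps_of_poly P = fps_const b * (\<Prod>y\<in>inverse ` S. 1 - fps_const y * fps_X)"
    by (simp add: fps_of_poly_smult fps_of_poly_prod fps_of_poly_pCons flip: fps_const_neg)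
  hence "fps_exp (- a) * fps_of_poly P = fps_const b * lp_fps a (inverse ` S)"
    by (simp add: lp_fps_def mult_ac)
  hence E: "b * lp_fps a (inverse ` S) $ n = (c * real n + b) * lp_fps a X $ n" for n
    using arg_cong[OF P, of "\<lambda>F. F $ n"]
    by (cases n) (simp_all add: algebra_simps mult.assoc)
  have "(c * real n + b) / b * lp_fps a X $ n = lp_fps a (inverse ` S) $ n" for n
    using E[of n] \<open>b > 0\<close> by (simp add: field_simps)
  hence "Abs_fps (\<lambda>n. (c * real n + b) / b * lp_fps a X $ n) = lp_fps a (inverse ` S)"
    by (intro fps_ext) simp
  thus ?thesis using S by (intro exI[of _ "inverse ` S"]) auto
qed

section \<open>Limits and the Euler-Rayleigh inequalities\<close>

text \<open>The argument type is generic since both instances occur: the real one locates zeros, the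
  complex one enters the starlikeness quotient.\<close>

definition pser :: "(nat \<Rightarrow> real) \<Rightarrow> 'a \<Rightarrow> 'a :: {real_normed_field,banach}" where
  "pser D z = (\<Sum>n. of_real (D n) * z ^ n)"

text \<open>Meaningful for \<open>k \<ge> 1\<close>: the sum of the \<open>k\<close>-th powers of the reciprocal zeros.\<close>
definition newton_sum :: "(nat \<Rightarrow> real) \<Rightarrow> nat \<Rightarrow> real" where
  "newton_sum D k = (- fps_deriv (Abs_fps D) * inverse (Abs_fps D)) $ (k - 1)"

section \<open>Newton's identities for the logarithmic derivative\<close>

lemma log_deriv_nth:
  fixes F S :: "real fps"
  assumes "fps_deriv F = - (F * S)" "F $ 0 = 1"
  shows "S $ k = - (real (Suc k) * F $ Suc k) - (\<Sum>i=1..k. F $ i * S $ (k - i))"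
proof -
  have "real (Suc k) * F $ Suc k = - ((F * S) $ k)"
    using arg_cong[OF assms(1), of "\<lambda>G. G $ k"] by simp
  also have "(F * S) $ k = S $ k + (\<Sum>i=1..k. F $ i * S $ (k - i))"
    by (simp add: fps_mult_nth sum.atLeast_Suc_atMost assms(2))
  finally show ?thesis by simp
qed

lemma fps_deriv_newton_sum:
  assumes "D 0 = 1"
  shows "fps_deriv (Abs_fps D) = - (Abs_fps D * Abs_fps (\<lambda>k. newton_sum D (Suc k)))"
proof -
  have "Abs_fps (\<lambda>k. newton_sum D (Suc k)) = - fps_deriv (Abs_fps D) * inverse (Abs_fps D)"
    by (intro fps_ext) (simp add: newton_sum_def)
  moreover have "Abs_fps D * inverse (Abs_fps D) = 1"
    using assms by (intro inverse_mult_eq_1') auto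
  ultimately show ?thesis by (simp add: mult.left_commute)
qed

lemma newton_sum_rec:
  assumes "D 0 = 1"
  shows "newton_sum D (Suc k) =
           - (real (Suc k) * D (Suc k)) - (\<Sum>i=1..k. D i * newton_sum D (Suc (k - i)))"
  using log_deriv_nth[OF fps_deriv_newton_sum[of D, OF assms], of k] assms by simp

text \<open>By Newton's identities the k-th coefficient of the logarithmic derivative is a
  polynomial in finitely many coefficients of F. Thus the power sums converge without any control of
  individual zeros.\<close>

lemma log_deriv_tendsto:
  fixes F S :: "nat \<Rightarrow> real fps"
  assumes "\<And>m. fps_deriv (F m) = - (F m * S m)" "\<And>m. F m $ 0 = 1"
    and "\<And>n. (\<lambda>m. F m $ n) \<longlonglongrightarrow> D n" "D 0 = 1"
  shows "(\<lambda>m. S m $ k) \<longlonglongrightarrow> newton_sum D (Suc k)"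
proof (induction k rule: less_induct)
  case (less k)
  have "(\<lambda>m. - (real (Suc k) * F m $ Suc k) - (\<Sum>i=1..k. F m $ i * S m $ (k - i))) \<longlonglongrightarrow>
      - (real (Suc k) * D (Suc k)) - (\<Sum>i=1..k. D i * newton_sum D (Suc (k - i)))"
    by (intro tendsto_intros assms(3) less.IH) auto
  thus ?case
    by (subst newton_sum_rec[of D, OF assms(4)]) (simp only: flip: log_deriv_nth[OF assms(1,2)])
qed

text \<open>Keeps products over the zeros away from \<open>0\<close> in terms of the first power sum alone.\<close>
lemma one_minus_ge_exp:
  fixes u :: real
  assumes "0 \<le> u" "u < 1"
  shows "1 - u \<ge> exp (- (u / (1 - u)))"
proof -
  have "ln (1 / (1 - u)) \<le> 1 / (1 - u) - 1"
    using assms by (intro ln_le_minus_one) auto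
  also have "\<dots> = u / (1 - u)" using assms by (simp add: field_simps)
  finally have "- (u / (1 - u)) \<le> ln (1 - u)" using assms by (simp add: ln_div)
  thus ?thesis using assms by (metis diff_gt_0_iff_gt exp_le_cancel_iff exp_ln)
qed

section \<open>Limits of exponentials times polynomials with positive zeros\<close>

locale hyperbolic_limit =
  fixes Dm :: "nat \<Rightarrow> nat \<Rightarrow> real" and D B :: "nat \<Rightarrow> real"
    and a :: "nat \<Rightarrow> real" and X :: "nat \<Rightarrow> real set"
  assumes finite_X: "\<And>m. finite (X m)" and X_pos: "\<And>m x. x \<in> X m \<Longrightarrow> x > 0"
    and a_pos: "\<And>m. a m > 0"
    and lp: "\<And>m. Abs_fps (Dm m) = lp_fps (a m) (X m)"
    and dominated: "\<And>m n. \<bar>Dm m n\<bar> \<le> B n"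
    and summable_B: "\<And>r::real. r \<ge> 0 \<Longrightarrow> summable (\<lambda>n. B n * r ^ n)"
    and lim: "\<And>n. (\<lambda>m. Dm m n) \<longlonglongrightarrow> D n"
begin

lemma D_bound: "\<bar>D n\<bar> \<le> B n"
  by (rule LIMSEQ_le_const2[OF tendsto_rabs[OF lim]]) (use dominated in auto)

lemma summable_pser:
  fixes z :: "'a :: {real_normed_field,banach}"
  assumes "\<And>n. \<bar>E n\<bar> \<le> B n"
  shows "summable (\<lambda>n. of_real (E n) * z ^ n)"
  by (rule summable_comparison_test'[OF summable_B[of "norm z"]])
     (use assms in \<open>auto simp: norm_mult norm_power intro!: mult_right_mono\<close>)

lemmas summable_D = summable_pser[OF D_bound] and summable_Dm = summable_pser[OF dominated]

lemma continuous_D: "continuous_on A (pser D :: 'a \<Rightarrow> 'a :: {real_normed_field,banach})"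
  unfolding pser_def
  by (intro continuous_at_imp_continuous_on ballI isCont_powser_converges_everywhere summable_D)

lemma Dm_0: "Dm m 0 = 1" and D_0: "D 0 = 1"
proof -
  show *: "Dm m 0 = 1" for m
    using arg_cong[OF lp[of m], of "\<lambda>F. F $ 0"] by (simp add: lp_fps_nth_0 finite_X)
  show "D 0 = 1" using lim[of 0] by (simp add: * LIMSEQ_const_iff)
qed

lemma pser_Dm:
  fixes z :: "'a :: {real_normed_field,banach}"
  shows "pser (Dm m) z = exp (- of_real (a m) * z) * (\<Prod>x\<in>X m. 1 - of_real x * z)"
proof -
  have "Dm m n = lp_fps (a m) (X m) $ n" for n
    using arg_cong[OF lp[of m], of "\<lambda>F. F $ n"] by simp
  thus ?thesis
    unfolding pser_def using lp_fps_sums[OF finite_X, of "a m" m z] by (simp add: sums_iff)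
qed

text \<open>On the disc of radius R the difference is at most the sum of
  \<open>\<bar>Dm m n - D n\<bar> * R ^ n\<close>, which does not involve z. Tannery's theorem with
  majorant \<open>2 * B n * R ^ n\<close> sends this sum to 0.\<close>

lemma uniform_conv:
  assumes "R \<ge> 0" "e > 0"
  shows "eventually (\<lambda>m. \<forall>z::'a::{real_normed_field,banach}. norm z \<le> R \<longrightarrow>
           norm (pser (Dm m) z - pser D z) < e) sequentially"
proof -
  have bound: "norm (\<bar>Dm m n - D n\<bar> * R ^ n) \<le> 2 * (B n * R ^ n)" for m n
  proof -
    have "\<bar>Dm m n - D n\<bar> \<le> 2 * B n" using dominated[of m n] D_bound[of n] by linarith
    hence "\<bar>Dm m n - D n\<bar> * R ^ n \<le> 2 * B n * R ^ n"
      using assms by (intro mult_right_mono) auto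
    thus ?thesis using assms by (simp add: abs_mult power_abs)
  qed
  have sum2: "summable (\<lambda>n. 2 * (B n * R ^ n))" using assms by (intro summable_mult summable_B)
  have "(\<lambda>m. \<Sum>n. \<bar>Dm m n - D n\<bar> * R ^ n) \<longlonglongrightarrow> (\<Sum>n. 0)"
  proof (rule tannerys_theorem[THEN conjunct2, THEN conjunct2])
    show "(\<lambda>m. \<bar>Dm m n - D n\<bar> * R ^ n) \<longlonglongrightarrow> 0" for n
      using lim[of n] by (intro tendsto_mult_left_zero tendsto_rabs_zero) (simp add: LIM_zero_iff)
    show "eventually (\<lambda>(n, m). norm (\<bar>Dm m n - D n\<bar> * R ^ n) \<le> 2 * (B n * R ^ n))
            (sequentially \<times>\<^sub>F sequentially)"
      by (intro always_eventually) (auto simp del: real_norm_def intro: bound)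
  qed (use sum2 in auto)
  hence "eventually (\<lambda>m. (\<Sum>n. \<bar>Dm m n - D n\<bar> * R ^ n) < e) sequentially"
    using \<open>e > 0\<close> by (intro order_tendstoD) auto
  thus ?thesis
  proof eventually_elim
    case (elim m)
    show ?case
    proof (intro allI impI)
      fix z :: 'a assume z: "norm z \<le> R"
      have s: "summable (\<lambda>n. \<bar>Dm m n - D n\<bar> * R ^ n)"
        by (rule summable_comparison_test'[OF sum2]) (use bound in auto)
      have le: "norm (of_real (Dm m n) * z ^ n - of_real (D n) * z ^ n) \<le> \<bar>Dm m n - D n\<bar> * R ^ n" for n
      proof -
        have "norm (of_real (Dm m n) * z ^ n - of_real (D n) * z ^ n) = \<bar>Dm m n - D n\<bar> * norm z ^ n"
          by (simp add: norm_mult norm_power flip: left_diff_distrib of_real_diff)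
        thus ?thesis using z by (simp add: mult_left_mono power_mono)
      qed
      have "norm (pser (Dm m) z - pser D z) =
          norm (\<Sum>n. of_real (Dm m n) * z ^ n - of_real (D n) * z ^ n)"
        unfolding pser_def by (subst suminf_diff) (auto intro: summable_D summable_Dm)
      also have "\<dots> \<le> (\<Sum>n. \<bar>Dm m n - D n\<bar> * R ^ n)"
        by (rule norm_suminf_le[OF le s])
      finally show "norm (pser (Dm m) z - pser D z) < e" using elim by simp
    qed
  qed
qed

lemma pointwise_conv:
  fixes z :: "'a :: {real_normed_field,banach}"
  shows "(\<lambda>m. pser (Dm m) z) \<longlonglongrightarrow> pser D z"
  unfolding tendsto_iff dist_norm
proof (intro allI impI)
  fix e :: real assume "e > 0"
  from uniform_conv[where ?'a = 'a, OF norm_ge_zero this, of z]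
  show "eventually (\<lambda>m. norm (pser (Dm m) z - pser D z) < e) sequentially"
    by eventually_elim auto
qed

text \<open>A Hurwitz-type argument on the real axis: the limit has a positive minimum on {0..R},
  and an approximant uniformly closer than that minimum cannot vanish there. The zeros are the
  numbers 1 / x, so x R < 1 places them beyond R.\<close>

lemma no_roots:
  assumes R: "R \<ge> 0" and pos: "\<And>r::real. 0 \<le> r \<Longrightarrow> r \<le> R \<Longrightarrow> pser D r > 0"
  shows "eventually (\<lambda>m. \<forall>x\<in>X m. x * R < 1) sequentially"
proof -
  have "\<exists>c\<in>{0..R}. \<forall>y\<in>{0..R}. pser D c \<le> pser D y"
    using R by (intro continuous_attains_inf continuous_D) auto
  then obtain c where c: "c \<in> {0..R}" "\<And>y. y \<in> {0..R} \<Longrightarrow> pser D c \<le> pser D y" by blast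
  have "pser D c > 0" using pos c(1) by auto
  from uniform_conv[where ?'a = real, OF R this]
  show ?thesis
  proof eventually_elim
    case (elim m)
    show ?case
    proof (rule ballI, rule ccontr)
      fix x assume x: "x \<in> X m" "\<not> x * R < 1"
      have "x > 0" using X_pos x by blast
      hence x': "0 \<le> inverse x" "inverse x \<le> R" using x by (auto simp: field_simps)
      have "\<exists>y\<in>X m. 1 - y * inverse x = 0" using x \<open>x > 0\<close> by (intro bexI[of _ x]) auto
      hence "pser (Dm m) (inverse x) = 0"
        unfolding pser_Dm using finite_X[of m] by (auto simp: prod_zero_iff)
      hence "pser D (inverse x) < pser D c"
        using elim x' by (auto dest!: spec[of _ "inverse x"])
      with c(2)[of "inverse x"] x' show False by auto
    qed
  qed
qed

section \<open>Power sums of the reciprocal zeros and their limits\<close>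

definition power_sum :: "nat \<Rightarrow> nat \<Rightarrow> real" where
  "power_sum m k = (\<Sum>x\<in>X m. x ^ k) + (if k = 1 then a m else 0)"

lemma power_sum_tendsto:
  assumes "k \<ge> 1"
  shows "(\<lambda>m. power_sum m k) \<longlonglongrightarrow> newton_sum D k"
proof -
  let ?S = "\<lambda>m. Abs_fps (\<lambda>k. (\<Sum>x\<in>X m. x ^ Suc k) + (if k = 0 then a m else 0))"
  have "(\<lambda>m. ?S m $ (k - 1)) \<longlonglongrightarrow> newton_sum D (Suc (k - 1))"
  proof (rule log_deriv_tendsto)
    show "fps_deriv (Abs_fps (Dm m)) = - (Abs_fps (Dm m) * ?S m)" for m
      unfolding lp by (rule fps_deriv_lp_fps[OF finite_X])
  qed (use Dm_0 D_0 lim in auto)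
  thus ?thesis using assms by (cases k) (simp_all add: power_sum_def)
qed

lemma newton_sum_nonneg: "k \<ge> 1 \<Longrightarrow> newton_sum D k \<ge> 0"
  by (rule LIMSEQ_le_const[OF power_sum_tendsto])
     (use X_pos a_pos in \<open>auto simp: power_sum_def less_imp_le intro!: add_nonneg_nonneg sum_nonneg\<close>)

text \<open>Once all zeros of the approximants lie beyond R, the inequality holds for each x
  separately. The exponential parameter \<open>a m\<close> can occur only on the larger side, at k =
  1.\<close>

lemma newton_sum_le:
  assumes "R \<ge> 0" "\<And>r::real. 0 \<le> r \<Longrightarrow> r \<le> R \<Longrightarrow> pser D r > 0" "k \<ge> 1"
  shows "newton_sum D (Suc k) * R \<le> newton_sum D k"
proof (rule tendsto_le)
  show "(\<lambda>m. power_sum m (Suc k) * R) \<longlonglongrightarrow> newton_sum D (Suc k) * R"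
    by (intro tendsto_intros power_sum_tendsto) auto
  show "(\<lambda>m. power_sum m k) \<longlonglongrightarrow> newton_sum D k" using assms by (intro power_sum_tendsto)
  have "eventually (\<lambda>m. \<forall>x\<in>X m. x * R < 1) sequentially"
    using assms by (intro no_roots) auto
  thus "eventually (\<lambda>m. power_sum m (Suc k) * R \<le> power_sum m k) sequentially"
  proof eventually_elim
    case (elim m)
    have "(\<Sum>x\<in>X m. x ^ Suc k) * R \<le> (\<Sum>x\<in>X m. x ^ k)"
      unfolding sum_distrib_right
    proof (rule sum_mono)
      fix x assume x: "x \<in> X m"
      have "x ^ k * (x * R) \<le> x ^ k * 1" using elim x X_pos[OF x] by (intro mult_left_mono) auto
      thus "x ^ Suc k * R \<le> x ^ k" by (simp add: mult_ac)
    qed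
    thus ?case using assms(3) a_pos[of m] by (auto simp: power_sum_def)
  qed
qed auto

text \<open>Cauchy-Schwarz for the square roots of x^k and x^(k+2). At k = 1 the term
  \<open>a m\<close> only enlarges the right-hand side, and at index k + 1 it is absent.\<close>

lemma newton_sum_cauchy_schwarz:
  assumes "k \<ge> 1"
  shows "(newton_sum D (Suc k))\<^sup>2 \<le> newton_sum D k * newton_sum D (Suc (Suc k))"
proof (rule LIMSEQ_le)
  show "(\<lambda>m. (power_sum m (Suc k))\<^sup>2) \<longlonglongrightarrow> (newton_sum D (Suc k))\<^sup>2"
    by (intro tendsto_intros power_sum_tendsto) auto
  show "(\<lambda>m. power_sum m k * power_sum m (Suc (Suc k))) \<longlonglongrightarrow> newton_sum D k * newton_sum D (Suc (Suc k))"
    using assms by (intro tendsto_intros power_sum_tendsto) auto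
  have "(power_sum m (Suc k))\<^sup>2 \<le> power_sum m k * power_sum m (Suc (Suc k))" for m
  proof -
    have "(\<Sum>x\<in>X m. x ^ Suc k)\<^sup>2 = (\<Sum>x\<in>X m. sqrt (x ^ k) * sqrt (x ^ Suc (Suc k)))\<^sup>2"
    proof (intro arg_cong[of _ _ "\<lambda>x. x\<^sup>2"] sum.cong refl)
      fix x assume "x \<in> X m"
      hence "x > 0" by (rule X_pos)
      have "sqrt (x ^ k) * sqrt (x ^ Suc (Suc k)) = sqrt ((x ^ Suc k)\<^sup>2)"
        by (simp add: power2_eq_square mult_ac flip: real_sqrt_mult)
      thus "x ^ Suc k = sqrt (x ^ k) * sqrt (x ^ Suc (Suc k))" using \<open>x > 0\<close> by simp
    qed
    also have "\<dots> \<le> (\<Sum>x\<in>X m. (sqrt (x ^ k))\<^sup>2) * (\<Sum>x\<in>X m. (sqrt (x ^ Suc (Suc k)))\<^sup>2)"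
      by (rule Cauchy_Schwarz_ineq_sum)
    also have "(\<Sum>x\<in>X m. (sqrt (x ^ k))\<^sup>2) = (\<Sum>x\<in>X m. x ^ k)"
      by (intro sum.cong) (auto dest!: X_pos)
    also have "(\<Sum>x\<in>X m. (sqrt (x ^ Suc (Suc k)))\<^sup>2) = (\<Sum>x\<in>X m. x ^ Suc (Suc k))"
      by (intro sum.cong) (auto dest!: X_pos)
    also have "(\<Sum>x\<in>X m. x ^ k) * (\<Sum>x\<in>X m. x ^ Suc (Suc k)) \<le>
        power_sum m k * power_sum m (Suc (Suc k))"
      using a_pos[of m] X_pos by (auto simp: power_sum_def less_imp_le intro!: mult_right_mono sum_nonneg)
    finally show ?thesis using assms by (simp add: power_sum_def)
  qed
  thus "\<exists>N. \<forall>m\<ge>N. (power_sum m (Suc k))\<^sup>2 \<le> power_sum m k * power_sum m (Suc (Suc k))" by blast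
qed

text \<open>A single x with x R at least 1 would already make R^k times the k-th power sum at least
  1, so the approximants have no zeros up to R. Strict positivity survives the limit because their
  values at r are bounded below by an exponential of the convergent first power sum.\<close>

lemma pser_pos:
  assumes "R > 0" "k \<ge> 1" "R ^ k * newton_sum D k < 1" "0 \<le> r" "r < R"
  shows "pser D r > (0::real)"
proof -
  \<comment> \<open>Since x r is below r / R, the exponent x r / (1 - x r) from
    \<open>one_minus_ge_exp\<close> is at most C x. Moreover C is at least r, so the factor exp (- a
    r) obeys the same bound.\<close>
  define C where "C = r / (1 - r / R)"
  have C: "C \<ge> r" using assms unfolding C_def by (simp add: field_simps)
  have "eventually (\<lambda>m. R ^ k * power_sum m k < 1) sequentially"
    using assms by (intro order_tendstoD(2)[OF _ assms(3)] tendsto_intros power_sum_tendsto)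
  hence "eventually (\<lambda>m. pser (Dm m) r \<ge> exp (- (C * power_sum m 1))) sequentially"
  proof eventually_elim
    case (elim m)
    have x: "x * R < 1" if "x \<in> X m" for x
    proof (rule ccontr)
      assume "\<not> x * R < 1"
      hence "1 \<le> (x * R) ^ k" by (intro one_le_power) auto
      also have "\<dots> = R ^ k * x ^ k" by (simp add: power_mult_distrib)
      also have "x ^ k \<le> (\<Sum>x\<in>X m. x ^ k)"
        using that X_pos finite_X by (intro member_le_sum) (auto simp: less_imp_le)
      also have "\<dots> \<le> power_sum m k" using a_pos[of m] by (simp add: power_sum_def)
      finally show False using elim assms(1) by (simp add: mult_left_mono)
    qed
    have "exp (- (C * (\<Sum>x\<in>X m. x))) = (\<Prod>x\<in>X m. exp (- (C * x)))"
      by (simp add: exp_sum finite_X sum_distrib_left flip: sum_negf)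
    also have "\<dots> \<le> (\<Prod>x\<in>X m. 1 - x * r)"
    proof (rule prod_mono, safe)
      fix x assume xX: "x \<in> X m"
      have "x > 0" by (rule X_pos[OF xX])
      have "x * r \<le> r / R" using x[OF xX] assms(1,4) mult_right_mono[of "x * R" 1 r]
        by (simp add: field_simps)
      moreover have "r / R < 1" using assms by (simp add: field_simps)
      ultimately have xr: "x * r < 1" "1 - r / R \<le> 1 - x * r" by linarith+
      have "x * r / (1 - x * r) \<le> x * r / (1 - r / R)"
        using xr(2) assms(4) \<open>x > 0\<close> \<open>r / R < 1\<close> xr(1)
        by (intro divide_left_mono mult_pos_pos mult_nonneg_nonneg) linarith+
      also have "\<dots> = C * x" by (simp add: C_def)
      finally have "exp (- (C * x)) \<le> exp (- (x * r / (1 - x * r)))" by simp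
      also have "\<dots> \<le> 1 - x * r" using xr assms \<open>x > 0\<close> by (intro one_minus_ge_exp) auto
      finally show "exp (- (C * x)) \<le> 1 - x * r" .
    qed auto
    finally have "exp (- (C * a m)) * exp (- (C * (\<Sum>x\<in>X m. x))) \<le>
        exp (- a m * r) * (\<Prod>x\<in>X m. 1 - x * r)"
      using C a_pos[of m] by (intro mult_mono) (auto simp: mult.commute[of C] mult_left_mono)
    thus ?case by (simp add: pser_Dm power_sum_def algebra_simps flip: exp_add)
  qed
  hence "exp (- (C * newton_sum D 1)) \<le> pser D r"
    by (intro tendsto_le[OF _ pointwise_conv _]) (auto intro!: tendsto_intros power_sum_tendsto)
  thus ?thesis using exp_gt_zero less_le_trans by blast
qed

end

section \<open>The least positive zero of the limit\<close>

context hyperbolic_limit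
begin

text \<open>The weak inequalities follow from the approximation results just below and just above
  the first zero \<tau>. The hypothesis \<open>non_exp\<close> makes those involving the third sum
  strict, and the other strict inequalities are derived from these and from
  \<open>D 2 > 0\<close>.\<close>

lemma euler_rayleigh_bounds:
  assumes D2: "D 2 > 0"
    and non_exp: "\<And>t. t > 0 \<Longrightarrow> \<exists>k\<ge>2. newton_sum D (Suc k) * t \<noteq> newton_sum D k"
  obtains \<tau> :: real where "\<tau> > 0" "pser D \<tau> = 0" "\<And>r. 0 \<le> r \<Longrightarrow> r < \<tau> \<Longrightarrow> pser D r > 0"
    and "newton_sum D 1 * \<tau> > 1" "newton_sum D 2 * \<tau>\<^sup>2 > 1"
    and "newton_sum D 2 * \<tau> < newton_sum D 1" "newton_sum D 3 * \<tau> < newton_sum D 2"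
    and "newton_sum D 3 > 0"
proof -
  let ?s = "newton_sum D"
  \<comment> \<open>If the second sum vanished, \<open>pser_pos\<close> would apply with every R and
    the limit would have no nonnegative zero. Then all later sums would vanish, and
    \<open>non_exp\<close> with t = 1 would fail.\<close>
  have s2_pos: "?s 2 > 0"
  proof (rule ccontr)
    assume "\<not> ?s 2 > 0"
    hence s2: "?s 2 = 0" using newton_sum_nonneg[of 2] by simp
    have pos: "pser D r > 0" if "r \<ge> 0" for r :: real
      using pser_pos[of "r + 1" 2 r] that s2 by simp
    have zero: "?s (Suc k) = 0" if "k \<ge> 1" for k
    proof -
      have "?s (Suc k) * R \<le> ?s k" if "R \<ge> 0" for R
        using that \<open>k \<ge> 1\<close> by (intro newton_sum_le pos) auto
      \<comment> \<open>This R turns the inequality into \<open>?s k + 1 \<le> ?s k\<close> unless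
        \<open>?s (Suc k)\<close> is 0.\<close>
      from this[of "(?s k + 1) / ?s (Suc k)"] newton_sum_nonneg[of "Suc k"] newton_sum_nonneg[of k] that
      show ?thesis by (cases "?s (Suc k) = 0") auto
    qed
    have "?s (Suc k) = 0 \<and> ?s k = 0" if "k \<ge> 2" for k
      using zero[of k] zero[of "k - 1"] that by auto
    thus False using non_exp[of 1] by force
  qed
  define Z where "Z = {r \<in> {0..}. pser D r \<le> (0::real)}"
  have "Z \<noteq> {}"
  proof
    assume "Z = {}"
    have pos: "pser D r > 0" if "r \<ge> 0" for r :: real
    proof (rule ccontr)
      assume "\<not> pser D r > 0"
      hence "r \<in> Z" using that by (simp add: Z_def)
      thus False using \<open>Z = {}\<close> by blast
    qed
    \<comment> \<open>The same choice of R, now with a positive second sum, shows that the limit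
      cannot stay positive on the whole half-line.\<close>
    have "?s (Suc 1) * ((?s 1 + 1) / ?s 2) \<le> ?s 1"
      using newton_sum_nonneg[of 1] s2_pos by (intro newton_sum_le pos) auto
    thus False using s2_pos by (simp add: numeral_2_eq_2)
  qed
  have "closed Z"
  proof -
    have "Z = {0..} \<inter> {r. pser D r \<le> 0}" by (auto simp: Z_def)
    thus ?thesis by (auto intro!: closed_Int closed_Collect_le continuous_D)
  qed
  define \<tau> where "\<tau> = Inf Z"
  have bdd: "bdd_below Z" by (rule bdd_belowI[of _ 0]) (simp add: Z_def)
  have "\<tau> \<in> Z" unfolding \<tau>_def by (intro closed_contains_Inf \<open>Z \<noteq> {}\<close> \<open>closed Z\<close> bdd)
  have "pser D 0 = (1 :: real)" by (simp add: pser_def D_0)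
  have "\<tau> \<noteq> 0" using \<open>\<tau> \<in> Z\<close> \<open>pser D 0 = 1\<close> by (auto simp: Z_def)
  hence \<tau>: "\<tau> > 0" using \<open>\<tau> \<in> Z\<close> by (auto simp: Z_def)
  have pos: "pser D r > 0" if "0 \<le> r" "r < \<tau>" for r :: real
  proof (rule ccontr)
    assume "\<not> pser D r > 0"
    hence "r \<in> Z" using that by (simp add: Z_def)
    thus False using cInf_lower[OF _ bdd] that unfolding \<tau>_def by force
  qed
  have root: "pser D \<tau> = 0"
  proof -
    have "\<exists>x\<ge>0. x \<le> \<tau> \<and> pser D x = (0::real)"
      using \<open>\<tau> \<in> Z\<close> \<open>pser D 0 = 1\<close> by (intro IVT2' continuous_D) (auto simp: Z_def)
    then obtain x :: real where "x \<ge> 0" "x \<le> \<tau>" "pser D x = 0" by blast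
    thus ?thesis using pos[of x] by (cases "x = \<tau>") auto
  qed
  \<comment> \<open>Positivity fails at \<tau> itself, so \<open>newton_sum_le\<close> is used at z
    \<tau> for every z < 1.\<close>
  have le: "?s (Suc k) * \<tau> \<le> ?s k" if "k \<ge> 1" for k
  proof (rule field_le_mult_one_interval)
    fix z :: real assume z: "0 < z" "z < 1"
    have "?s (Suc k) * (z * \<tau>) \<le> ?s k"
    proof (rule newton_sum_le)
      fix r assume "0 \<le> r" "r \<le> z * \<tau>"
      moreover have "z * \<tau> < 1 * \<tau>" using z \<tau> by (intro mult_strict_right_mono) auto
      ultimately show "pser D r > 0" by (intro pos) auto
    qed (use z \<tau> that in auto)
    thus "z * (?s (Suc k) * \<tau>) \<le> ?s k" by (simp add: mult_ac)
  qed
  \<comment> \<open>A strict failure at \<tau> would persist for some R > \<tau> by continuity in R,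
    and \<open>pser_pos\<close> would then make the limit positive at its zero \<tau>.\<close>
  have ge: "?s k * \<tau> ^ k \<ge> 1" if "k \<ge> 1" for k
  proof (rule ccontr)
    assume "\<not> ?s k * \<tau> ^ k \<ge> 1"
    hence "\<tau> ^ k * ?s k < 1" by (simp add: mult.commute)
    moreover have "((\<lambda>R. R ^ k * ?s k) \<longlongrightarrow> \<tau> ^ k * ?s k) (at_right \<tau>)" by (intro tendsto_intros)
    ultimately have "eventually (\<lambda>R. R ^ k * ?s k < 1) (at_right \<tau>)" by (rule order_tendstoD(2)[rotated])
    hence "eventually (\<lambda>R. R > \<tau> \<and> R ^ k * ?s k < 1) (at_right \<tau>)"
      by (intro eventually_conj eventually_at_right_less)
    hence "\<exists>R. R > \<tau> \<and> R ^ k * ?s k < 1"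
      by (intro eventually_happens'[of "at_right \<tau>"]) auto
    then obtain R where "R > \<tau>" "R ^ k * ?s k < 1" by blast
    hence "pser D \<tau> > (0 :: real)" using \<tau> that by (intro pser_pos[of R k \<tau>]) auto
    thus False using root by simp
  qed
  have s_pos: "?s k > 0" if "k \<ge> 1" for k
  proof -
    have "?s k \<noteq> 0" using ge[OF that] by auto
    thus ?thesis using newton_sum_nonneg[OF that] by simp
  qed
  \<comment> \<open>Equality at k = 2 propagates upwards: equality at k and Cauchy-Schwarz give one
    inequality at k + 1, and \<open>le\<close> gives the other.\<close>
  have lt3: "?s 3 * \<tau> < ?s 2"
  proof (rule ccontr)
    assume "\<not> ?s 3 * \<tau> < ?s 2"
    hence eq: "?s (Suc 2) * \<tau> = ?s 2" using le[of 2] by (simp add: numeral_3_eq_3)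
    have "?s (Suc k) * \<tau> = ?s k" if "k \<ge> 2" for k
      using that
    proof (induction k rule: dec_induct)
      case (step k)
      have "(?s (Suc k))\<^sup>2 \<le> ?s k * ?s (Suc (Suc k))"
        using step.hyps by (intro newton_sum_cauchy_schwarz) auto
      also have "\<dots> = ?s (Suc k) * (?s (Suc (Suc k)) * \<tau>)" by (simp flip: step.IH)
      finally have "?s (Suc k) \<le> ?s (Suc (Suc k)) * \<tau>"
        using s_pos[of "Suc k"] by (simp add: power2_eq_square)
      thus ?case using le[of "Suc k"] by simp
    qed (fact eq)
    thus False using non_exp[OF \<tau>] by blast
  qed
  \<comment> \<open>Equality here and Cauchy-Schwarz would force s_2 \<le> s_3 \<tau>, against
    \<open>lt3\<close>.\<close>
  have lt2: "?s 2 * \<tau> < ?s 1"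
  proof (rule ccontr)
    assume "\<not> ?s 2 * \<tau> < ?s 1"
    hence eq: "?s 1 = ?s 2 * \<tau>" using le[of 1] by (simp add: numeral_2_eq_2)
    have "(?s 2)\<^sup>2 \<le> ?s 1 * ?s 3"
      using newton_sum_cauchy_schwarz[of 1] by (simp add: numeral_2_eq_2 numeral_3_eq_3)
    also have "\<dots> = ?s 2 * (?s 3 * \<tau>)" by (simp only: eq mult_ac)
    also have "\<dots> < ?s 2 * ?s 2" using lt3 s2_pos by (intro mult_strict_left_mono) auto
    finally show False by (simp add: power2_eq_square)
  qed
  have "?s 2 * \<tau>\<^sup>2 > 1"
  proof -
    have "1 \<le> ?s 3 * \<tau> ^ 3" by (rule ge) auto
    also have "\<dots> = (?s 3 * \<tau>) * \<tau>\<^sup>2" by (simp add: power2_eq_square power3_eq_cube)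
    also have "\<dots> < ?s 2 * \<tau>\<^sup>2" using lt3 \<tau> by (intro mult_strict_right_mono) auto
    finally show ?thesis .
  qed
  \<comment> \<open>Newton's identities give s_1^2 - s_2 = 2 D_2, so s_2 < s_1^2.\<close>
  moreover have "?s 1 * \<tau> > 1"
  proof -
    have "?s 1 = - D 1" using newton_sum_rec[of D 0] D_0 by simp
    moreover have "?s 2 = - 2 * D 2 - D 1 * ?s 1"
      using newton_sum_rec[of D 1] D_0 by (simp add: numeral_2_eq_2)
    ultimately have "?s 2 < (?s 1)\<^sup>2" using D2 by (simp add: power2_eq_square)
    hence "?s 2 * \<tau>\<^sup>2 < (?s 1)\<^sup>2 * \<tau>\<^sup>2" using \<tau> by (intro mult_strict_right_mono) auto
    hence "1\<^sup>2 < (?s 1 * \<tau>)\<^sup>2" using ge[of 2] by (simp add: power_mult_distrib)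
    thus ?thesis using s_pos[of 1] \<tau> by (intro power_less_imp_less_base[of 1 2]) auto
  qed
  ultimately show ?thesis using that \<tau> root pos lt2 lt3 s_pos[of 3] by simp
qed

end

section \<open>The radius of starlikeness\<close>

lemma has_field_derivative_ident_times_pser:
  fixes z :: "'a :: {real_normed_field,banach}"
  assumes "\<And>y::'a. summable (\<lambda>n. of_real (L n) * y ^ n)"
  shows "((\<lambda>z. z * pser L z) has_field_derivative pser (\<lambda>n. real (Suc n) * L n) z) (at z)"
proof -
  define c where "c n = (of_real (if n = 0 then 0 else L (n - 1)) :: 'a)" for n
  have sums: "(\<lambda>n. c n * y ^ n) sums (y * pser L y)" for y
  proof -
    have "(\<lambda>n. y * (of_real (L n) * y ^ n)) sums (y * pser L y)"
      unfolding pser_def by (intro sums_mult summable_sums assms)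
    hence "(\<lambda>n. c (Suc n) * y ^ Suc n) sums (y * pser L y)" by (simp add: c_def mult_ac)
    thus ?thesis by (subst (asm) sums_Suc_iff) (simp add: c_def)
  qed
  have "((\<lambda>y. \<Sum>n. c n * y ^ n) has_field_derivative (\<Sum>n. diffs c n * z ^ n)) (at z)"
    by (rule termdiffs_strong_converges_everywhere) (use sums in \<open>auto simp: sums_iff\<close>)
  also have "(\<lambda>y. \<Sum>n. c n * y ^ n) = (\<lambda>y. y * pser L y)" using sums by (simp add: sums_iff)
  also have "(\<Sum>n. diffs c n * z ^ n) = pser (\<lambda>n. real (Suc n) * L n) z"
    by (simp add: pser_def diffs_def c_def)
  finally show ?thesis .
qed

text \<open>Write w / (1 - w) as 1 / (1 - w) - 1 and use |1 - w| \<ge> 1 - |w|. With w = x z, this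
  says that the contribution of each zero is extremal on the positive axis.\<close>

lemma Re_div_one_minus_le:
  assumes "norm w < 1"
  shows "Re (w / (1 - w)) \<le> norm w / (1 - norm w)"
proof -
  have "w \<noteq> 1" using assms by auto
  hence "w / (1 - w) = 1 / (1 - w) - 1" by (simp add: field_simps)
  hence "Re (w / (1 - w)) = Re (1 / (1 - w)) - 1" by simp
  also have "Re (1 / (1 - w)) \<le> norm (1 / (1 - w))" by (rule complex_Re_le_cmod)
  also have "\<dots> = 1 / norm (1 - w)" by (simp add: norm_divide)
  also have "\<dots> \<le> 1 / (1 - norm w)"
    using assms norm_triangle_ineq2[of 1 w] by (intro divide_left_mono mult_pos_pos) auto
  also have "\<dots> - 1 = norm w / (1 - norm w)" using assms by (simp add: field_simps)
  finally show ?thesis by simp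
qed

lemma has_field_derivative_exp_prod:
  fixes z :: "'a :: {real_normed_field,banach}"
  assumes "finite X" "\<And>x. x \<in> X \<Longrightarrow> 1 - of_real x * z \<noteq> 0"
  shows "((\<lambda>z. exp (- of_real a * z) * (\<Prod>x\<in>X. 1 - of_real x * z)) has_field_derivative
           - (exp (- of_real a * z) * (\<Prod>x\<in>X. 1 - of_real x * z)) *
             (of_real a + (\<Sum>x\<in>X. of_real x / (1 - of_real x * z)))) (at z)"
  using assms
proof (induction X rule: finite_induct)
  case empty
  show ?case by (auto intro!: derivative_eq_intros)
next
  case (insert x X)
  let ?f = "\<lambda>X z. exp (- of_real a * z) * (\<Prod>x\<in>X. 1 - of_real x * z)"
  let ?S = "\<lambda>X. of_real a + (\<Sum>x\<in>X. of_real x / (1 - of_real x * z))"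
  have "((\<lambda>z. ?f X z * (1 - of_real x * z)) has_field_derivative
      (- ?f X z * ?S X) * (1 - of_real x * z) + - of_real x * ?f X z) (at z)"
    using insert by (intro DERIV_mult insert.IH) (auto intro!: derivative_eq_intros)
  also have "(\<lambda>z. ?f X z * (1 - of_real x * z)) = ?f (insert x X)"
    using insert.hyps by (simp add: mult_ac)
  also have "(- ?f X z * ?S X) * (1 - of_real x * z) + - of_real x * ?f X z =
      - (?f X z * (1 - of_real x * z)) * (?S X + of_real x / (1 - of_real x * z))"
    using insert.prems[of x] by (simp add: field_simps)
  also have "?f X z * (1 - of_real x * z) = ?f (insert x X) z"
    using insert.hyps by (simp add: mult_ac)
  also have "?S X + of_real x / (1 - of_real x * z) = ?S (insert x X)"
    using insert.hyps by simp
  finally show ?case .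
qed

text \<open>L stands for h(z) / z and G for h'(z), so that G / L is z h'(z) / h(z). Zeros of L
  control this quotient on circles, while those of G determine the radius.\<close>

locale starlike_limit =
  L: hyperbolic_limit Lm L BL aL XL + G: hyperbolic_limit Gm G BG aG XG
  for Lm L BL aL XL Gm G BG aG XG +
  assumes Gm: "\<And>m n. Gm m n = real (Suc n) * Lm m n"
begin

lemma G: "G n = real (Suc n) * L n"
proof -
  have "(\<lambda>m. Gm m n) \<longlonglongrightarrow> real (Suc n) * L n" unfolding Gm by (intro tendsto_intros L.lim)
  thus ?thesis using G.lim[of n] LIMSEQ_unique by blast
qed

lemma deriv_L: "((\<lambda>z::'a::{real_normed_field,banach}. z * pser L z) has_field_derivative pser G z) (at z)"
  using has_field_derivative_ident_times_pser[OF L.summable_D, of z] by (simp add: G[abs_def])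

text \<open>The function z times \<open>pser (Lm m) z\<close> is differentiated twice over, termwise
  and as a product; uniqueness of the derivative equates the results.\<close>

lemma pser_Gm:
  fixes z :: "'a::{real_normed_field,banach}"
  assumes "\<And>x. x \<in> XL m \<Longrightarrow> 1 - of_real x * z \<noteq> 0"
  shows "pser (Gm m) z = pser (Lm m) z *
    (1 - (of_real (aL m) * z + (\<Sum>x\<in>XL m. of_real x * z / (1 - of_real x * z))))"
proof -
  have "((\<lambda>z. z * pser (Lm m) z) has_field_derivative pser (Gm m) z) (at z)"
    using has_field_derivative_ident_times_pser[of "Lm m" z, OF L.summable_Dm] by (simp add: Gm[abs_def])
  moreover have "((\<lambda>z. z * pser (Lm m) z) has_field_derivative
      (1 * pser (Lm m) z + - pser (Lm m) z *
         (of_real (aL m) + (\<Sum>x\<in>XL m. of_real x / (1 - of_real x * z))) * z)) (at z)"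
    unfolding L.pser_Dm
    by (intro DERIV_mult DERIV_ident has_field_derivative_exp_prod L.finite_X assms)
  ultimately have "pser (Gm m) z = 1 * pser (Lm m) z + - pser (Lm m) z *
         (of_real (aL m) + (\<Sum>x\<in>XL m. of_real x / (1 - of_real x * z))) * z"
    by (rule DERIV_unique)
  thus ?thesis by (simp add: algebra_simps sum_distrib_left sum_distrib_right sum_negf)
qed

lemma approx_bounds:
  fixes z :: complex
  assumes x: "\<And>x. x \<in> XL m \<Longrightarrow> x * norm z < 1"
  shows "norm (pser (Lm m) z) \<ge> pser (Lm m) (norm z)"
    and "Re (pser (Gm m) z / pser (Lm m) z) \<ge> pser (Gm m) (norm z) / pser (Lm m) (norm z)"
proof -
  let ?r = "norm z"
  have nrm: "norm (of_real x * z) = x * ?r" if "x \<in> XL m" for x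
    using L.X_pos[OF that] by (simp add: norm_mult)
  have ge: "norm (1 - of_real x * z) \<ge> 1 - x * ?r" if "x \<in> XL m" for x
    using norm_triangle_ineq2[of 1 "of_real x * z"] nrm[OF that] by simp
  have ne: "1 - of_real x * z \<noteq> 0" if "x \<in> XL m" for x
    using ge[OF that] x[OF that] by auto
  have ne': "1 - x * ?r \<noteq> 0" if "x \<in> XL m" for x
    using x[OF that] by auto
  have az: "aL m * Re z \<le> aL m * ?r"
    using L.a_pos[of m] by (intro mult_left_mono complex_Re_le_cmod) auto
  have "pser (Lm m) ?r \<le> exp (- (aL m * Re z)) * (\<Prod>x\<in>XL m. norm (1 - of_real x * z))"
    unfolding L.pser_Dm using az x ge
    by (intro mult_mono prod_mono prod_nonneg conjI) (auto simp: less_imp_le)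
  also have "\<dots> = norm (pser (Lm m) z)"
    unfolding L.pser_Dm by (simp add: norm_mult flip: prod_norm)
  finally show "norm (pser (Lm m) z) \<ge> pser (Lm m) ?r" .
  have "pser (Lm m) z \<noteq> 0"
    unfolding L.pser_Dm using ne L.finite_X by (simp add: prod_zero_iff)
  hence "pser (Gm m) z / pser (Lm m) z =
      1 - (of_real (aL m) * z + (\<Sum>x\<in>XL m. of_real x * z / (1 - of_real x * z)))"
    by (subst pser_Gm) (use ne in auto)
  hence "Re (pser (Gm m) z / pser (Lm m) z) =
      1 - (aL m * Re z + (\<Sum>x\<in>XL m. Re (of_real x * z / (1 - of_real x * z))))"
    by simp
  also have "\<dots> \<ge> 1 - (aL m * ?r + (\<Sum>x\<in>XL m. x * ?r / (1 - x * ?r)))"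
  proof (intro diff_left_mono add_mono sum_mono az)
    fix y assume y: "y \<in> XL m"
    show "Re (of_real y * z / (1 - of_real y * z)) \<le> y * ?r / (1 - y * ?r)"
      using Re_div_one_minus_le[of "of_real y * z"] x[OF y] nrm[OF y] by simp
  qed
  also have "1 - (aL m * ?r + (\<Sum>x\<in>XL m. x * ?r / (1 - x * ?r))) = pser (Gm m) ?r / pser (Lm m) ?r"
  proof -
    have "pser (Lm m) ?r \<noteq> 0"
      unfolding L.pser_Dm using ne' L.finite_X by (simp add: prod_zero_iff)
    thus ?thesis by (subst pser_Gm) (use ne' in auto)
  qed
  finally show "Re (pser (Gm m) z / pser (Lm m) z) \<ge> pser (Gm m) ?r / pser (Lm m) ?r" .
qed

text \<open>Positivity of h' up to |z| makes h, and hence L, positive there by the mean value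
  theorem. The approximants of L then have no zeros in that range, and both bounds of
  \<open>approx_bounds\<close> pass to the limit; the first keeps L from vanishing at z.\<close>

lemma quotient_pos:
  fixes z :: complex
  assumes pos: "\<And>r::real. 0 \<le> r \<Longrightarrow> r \<le> norm z \<Longrightarrow> pser G r > 0"
  shows "Re (pser G z / pser L z) > 0"
proof -
  have L_pos: "pser L r > 0" if r: "0 \<le> r" "r \<le> norm z" for r :: real
  proof (cases "r = 0")
    case True
    thus ?thesis by (simp add: pser_def L.D_0)
  next
    case False
    hence "\<exists>c>0. c < r \<and> r * pser L r - 0 * pser L 0 = (r - 0) * pser G c"
      using r by (intro MVT2 deriv_L) auto
    then obtain c where "0 < c" "c < r" "r * pser L r = r * pser G c" by auto
    thus ?thesis using pos[of c] r False by simp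
  qed
  have "eventually (\<lambda>m. \<forall>x\<in>XL m. x * norm z < 1) sequentially"
    using L_pos by (intro L.no_roots) auto
  hence ev: "eventually (\<lambda>m. pser (Lm m) (norm z) \<le> norm (pser (Lm m) z) \<and>
      pser (Gm m) (norm z) / pser (Lm m) (norm z) \<le> Re (pser (Gm m) z / pser (Lm m) z)) sequentially"
    by eventually_elim (use approx_bounds in auto)
  have Lr: "pser L (norm z) > 0" by (rule L_pos) auto
  have "pser L (norm z) \<le> norm (pser L z)"
    by (rule tendsto_le[OF _ tendsto_norm[OF L.pointwise_conv] L.pointwise_conv])
       (use ev in \<open>auto elim: eventually_mono\<close>)
  hence Lz: "pser L z \<noteq> 0" using Lr by auto
  have "pser G (norm z) / pser L (norm z) \<le> Re (pser G z / pser L z)"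
  proof (rule tendsto_le)
    show "(\<lambda>m. Re (pser (Gm m) z / pser (Lm m) z)) \<longlonglongrightarrow> Re (pser G z / pser L z)"
      by (intro tendsto_intros L.pointwise_conv G.pointwise_conv Lz)
    show "(\<lambda>m. pser (Gm m) (norm z) / pser (Lm m) (norm z)) \<longlonglongrightarrow> pser G (norm z) / pser L (norm z)"
      using Lr by (intro tendsto_intros L.pointwise_conv G.pointwise_conv) auto
  qed (use ev in \<open>auto elim: eventually_mono\<close>)
  moreover have "pser G (norm z) / pser L (norm z) > 0" using Lr pos[of "norm z"] by simp
  ultimately show ?thesis by linarith
qed

text \<open>At \<tau> the numerator h' vanishes, so no open disc containing \<tau> is admissible.
  The open disc of radius \<tau> itself is, and the supremum is attained.\<close>

lemma radius_of_starlikeness_eq: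
  assumes "\<tau> > 0" "pser G \<tau> = 0" "\<And>r. 0 \<le> r \<Longrightarrow> r < \<tau> \<Longrightarrow> pser G r > 0"
    and f: "\<And>z. f z = z * pser L z"
  shows "radius_of_starlikeness f = ereal \<tau>"
proof -
  have deriv: "deriv f z = pser G z" for z
    unfolding f by (rule DERIV_imp_deriv[OF deriv_L])
  have "{r. r > 0 \<and> (\<forall>z\<in>ball 0 r. Re (starlike_quot f z) > 0)} = {0<..\<tau>}"
  proof (intro equalityI subsetI)
    fix r assume "r \<in> {r. r > 0 \<and> (\<forall>z\<in>ball 0 r. Re (starlike_quot f z) > 0)}"
    hence r: "r > 0" "\<And>z. norm z < r \<Longrightarrow> Re (starlike_quot f z) > 0" by auto
    have "pser G (complex_of_real \<tau>) = of_real (pser G \<tau>)"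
      unfolding pser_def by (subst suminf_of_real) (auto intro: G.summable_D[where ?'a = real, simplified])
    hence "starlike_quot f (of_real \<tau>) = 0"
      using assms(1,2) by (simp add: starlike_quot_def deriv)
    hence "\<not> norm (complex_of_real \<tau>) < r" using r(2)[of "of_real \<tau>"] by auto
    thus "r \<in> {0<..\<tau>}" using r(1) assms(1) by simp
  next
    fix r assume r: "r \<in> {0<..\<tau>}"
    have "Re (starlike_quot f z) > 0" if "norm z < r" for z
    proof (cases "z = 0")
      case False
      have "Re (pser G z / pser L z) > 0" using that r by (intro quotient_pos assms(3)) auto
      thus ?thesis using False by (simp add: starlike_quot_def deriv f)
    qed (simp add: starlike_quot_def)
    thus "r \<in> {r. r > 0 \<and> (\<forall>z\<in>ball 0 r. Re (starlike_quot f z) > 0)}" using r by auto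
  qed
  hence "{ereal r |r. r > 0 \<and> (\<forall>z\<in>ball 0 r. Re (starlike_quot f z) > 0)} = ereal ` {0<..\<tau>}"
    by blast
  moreover have "Sup (ereal ` {0<..\<tau>}) = ereal \<tau>"
    using assms(1) by (intro cSup_eq_maximum) auto
  ultimately show ?thesis by (simp add: radius_of_starlikeness_def)
qed

end

section \<open>Strictness from the growth of Gamma\<close>

text \<open>
  If the sums were geometric from \<open>k = 2\<close> on, then \<open>(t - X) F' = (c1 X - c0) F\<close> with constants
  \<open>c0\<close>, \<open>c1\<close>; the resulting recurrence bounds \<open>d n\<close> by a multiple of \<open>n * d (n + 1)\<close>.
\<close>
lemma newton_sum_not_eventually_geometric:
  fixes d :: "nat \<Rightarrow> real"
  assumes d: "\<And>n. d n > 0" "d 0 = 1"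
    and growth: "filterlim (\<lambda>n. d n / (real (Suc n) * d (Suc n))) at_top sequentially"
    and "t > 0"
  shows "\<exists>k\<ge>2. newton_sum (\<lambda>n. (- 1) ^ n * d n) (Suc k) * t \<noteq> newton_sum (\<lambda>n. (- 1) ^ n * d n) k"
proof (rule ccontr)
  let ?D = "\<lambda>n. (- 1) ^ n * d n"
  let ?s = "newton_sum ?D"
  let ?F = "Abs_fps ?D" and ?S = "Abs_fps (\<lambda>k. ?s (Suc k))"
  let ?p = "\<lambda>n. d n / (real (Suc n) * d (Suc n))"
  assume "\<not> ?thesis"
  hence geom: "?s (Suc k) * t = ?s k" if "k \<ge> 2" for k using that by blast
  define c1 where "c1 = ?s 1 - t * ?s 2"
  have D0: "?D 0 = 1" using d by simp
  have s1: "?s 1 = d 1" using newton_sum_rec[of ?D 0, OF D0] by simp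
  have S: "?S * (fps_const t - fps_X) = fps_const (t * ?s 1) - fps_const c1 * fps_X"
  proof (rule fps_ext)
    fix n
    consider "n = 0" | "n = 1" | k where "n = Suc (Suc k)"
      by (metis One_nat_def not0_implies_Suc)
    thus "(?S * (fps_const t - fps_X)) $ n = (fps_const (t * ?s 1) - fps_const c1 * fps_X) $ n"
      using geom[of n] by cases (simp_all add: algebra_simps c1_def numeral_2_eq_2)
  qed
  have "fps_deriv ?F * (fps_const t - fps_X) = - (?F * (?S * (fps_const t - fps_X)))"
    by (subst fps_deriv_newton_sum[of ?D, OF D0]) (simp add: mult.assoc)
  also have "\<dots> = ?F * (fps_const c1 * fps_X) - ?F * fps_const (t * ?s 1)"
    unfolding S by (simp add: algebra_simps)
  finally have E: "(fps_deriv ?F * (fps_const t - fps_X)) $ Suc n =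
      (?F * (fps_const c1 * fps_X) - ?F * fps_const (t * ?s 1)) $ Suc n" for n by simp
  have rec: "t * (real (n + 2) * d (n + 2)) + real (Suc n) * d (Suc n) = c1 * d n + t * ?s 1 * d (Suc n)" for n
  proof -
    have "(- 1) ^ n * (t * (real (n + 2) * d (n + 2)) + real (Suc n) * d (Suc n)) =
        (- 1) ^ n * (c1 * d n + t * ?s 1 * d (Suc n))"
      using E[of n] by (simp add: algebra_simps)
    thus ?thesis by simp
  qed
  \<comment> \<open>In \<open>rec\<close> the first condition forces c1 > 0. The third gives (n + 2)
    d_(n+2) < d_(n+1), whence c1 d_n < (1 + t) (n + 1) d_(n+1), which contradicts the
    second.\<close>
  have "eventually (\<lambda>n. real n > t * ?s 1 \<and> ?p n > (1 + t) / c1 \<and> ?p (Suc n) > 1) sequentially"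
  proof (intro eventually_conj)
    show "eventually (\<lambda>n. real n > t * ?s 1) sequentially"
      using filterlim_real_sequentially by (simp add: filterlim_at_top_dense)
    show "eventually (\<lambda>n. ?p n > (1 + t) / c1) sequentially"
      using growth by (simp add: filterlim_at_top_dense)
    have "eventually (\<lambda>n. ?p n > 1) sequentially"
      using growth by (simp add: filterlim_at_top_dense)
    thus "eventually (\<lambda>n. ?p (Suc n) > 1) sequentially" by (subst eventually_sequentially_Suc)
  qed
  then obtain n where n: "real n > t * ?s 1" "?p n > (1 + t) / c1" "?p (Suc n) > 1"
    using eventually_happens by fastforce
  have pos: "d n > 0" "d (Suc n) > 0" "d (n + 2) > 0" by (rule d)+
  have "t * (real (n + 2) * d (n + 2)) > 0" using pos(3) \<open>t > 0\<close> by simp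
  moreover have "(real (Suc n) - t * ?s 1) * d (Suc n) > 0" using n(1) pos by simp
  ultimately have "c1 * d n > 0" using rec[of n] by (simp add: algebra_simps)
  hence c1: "c1 > 0" using pos(1) by (simp add: zero_less_mult_iff)
  have "real (n + 2) * d (n + 2) < d (Suc n)"
  proof -
    have "1 * (real (n + 2) * d (n + 2)) < ?p (Suc n) * (real (n + 2) * d (n + 2))"
      using n(3) pos by (intro mult_strict_right_mono) auto
    also have "\<dots> = d (Suc n)" using pos by simp
    finally show ?thesis by simp
  qed
  hence "t * (real (n + 2) * d (n + 2)) < t * d (Suc n)" using \<open>t > 0\<close> by (rule mult_strict_left_mono)
  moreover have "t * ?s 1 * d (Suc n) \<ge> 0" using \<open>t > 0\<close> d(1)[of 1] pos unfolding s1 by simp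
  ultimately have "c1 * d n < t * d (Suc n) + real (Suc n) * d (Suc n)" using rec[of n] by simp
  also have "\<dots> \<le> (1 + t) * (real (Suc n) * d (Suc n))"
  proof -
    have "t * d (Suc n) * 1 \<le> t * d (Suc n) * real (Suc n)"
      using \<open>t > 0\<close> pos by (intro mult_left_mono) auto
    thus ?thesis by (simp add: algebra_simps)
  qed
  also have "\<dots> < c1 * d n" using n(2) c1 pos by (simp add: field_simps del: of_nat_Suc)
  finally show False .
qed

section \<open>Growth of Gamma from logarithmic convexity\<close>

lemma Gamma_ratio_ge:
  fixes x \<rho> :: real
  assumes "x > 1" "\<rho> > 0"
  shows "Gamma (x + \<rho>) \<ge> (x - 1) powr \<rho> * Gamma x"
proof -
  \<comment> \<open>The weight that places x between x - 1 and x + \<rho>. Convexity then compares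
    the growth of ln Gamma beyond x with its increment ln (x - 1) over the preceding unit
    interval.\<close>
  define t where "t = 1 / (1 + \<rho>)"
  have t: "0 \<le> t" "t \<le> 1" using assms by (auto simp: t_def)
  have x: "(1 - t) *\<^sub>R (x - 1) + t *\<^sub>R (x + \<rho>) = x"
  proof -
    have "(1 - t) *\<^sub>R (x - 1) + t *\<^sub>R (x + \<rho>) = x - 1 + t * (1 + \<rho>)"
      by (simp add: algebra_simps)
    also have "t * (1 + \<rho>) = 1" using assms by (simp add: t_def)
    finally show ?thesis by simp
  qed
  have "ln (Gamma x) \<le> (1 - t) * ln (Gamma (x - 1)) + t * ln (Gamma (x + \<rho>))"
    using convex_onD[OF log_convex_Gamma_real t, of "x - 1" "x + \<rho>"] assms x by simp
  hence "(1 + \<rho>) * ln (Gamma x) \<le>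
      (1 + \<rho>) * ((1 - t) * ln (Gamma (x - 1)) + t * ln (Gamma (x + \<rho>)))"
    using assms by (intro mult_left_mono) auto
  also have "\<dots> = ((1 + \<rho>) * (1 - t)) * ln (Gamma (x - 1)) + ((1 + \<rho>) * t) * ln (Gamma (x + \<rho>))"
    by (simp add: algebra_simps)
  also have "(1 + \<rho>) * t = 1" using assms by (simp add: t_def)
  also have "(1 + \<rho>) * (1 - t) = \<rho>" using assms by (simp add: t_def field_simps)
  finally have *: "ln (Gamma x) + \<rho> * (ln (Gamma x) - ln (Gamma (x - 1))) \<le> ln (Gamma (x + \<rho>))"
    by (simp add: algebra_simps)
  have Gx: "Gamma (x - 1) > 0" using assms by (intro Gamma_real_pos) auto
  have "Gamma x = (x - 1) * Gamma (x - 1)"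
  proof -
    have "x - 1 \<notin> \<int>\<^sub>\<le>\<^sub>0" using assms nonpos_Ints_nonpos[of "x - 1"] by auto
    thus ?thesis using Gamma_plus1[of "x - 1"] by simp
  qed
  hence "ln (Gamma x) = ln ((x - 1) * Gamma (x - 1))" by (rule arg_cong)
  also have "\<dots> = ln (x - 1) + ln (Gamma (x - 1))" using assms Gx by (intro ln_mult_pos) auto
  finally have "ln (Gamma x) - ln (Gamma (x - 1)) = ln (x - 1)" by simp
  with * have "ln (Gamma x) + \<rho> * ln (x - 1) \<le> ln (Gamma (x + \<rho>))" by simp
  moreover have "Gamma x > 0" "Gamma (x + \<rho>) > 0" using assms by (auto intro!: Gamma_real_pos)
  moreover from this assms have "ln ((x - 1) powr \<rho> * Gamma x) = \<rho> * ln (x - 1) + ln (Gamma x)"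
    by (subst ln_mult_pos) (auto simp: ln_powr)
  ultimately show ?thesis using assms
    by (subst ln_le_cancel_iff[symmetric]) auto
qed

section \<open>The Wright function\<close>

locale wright_parameters =
  fixes \<rho> \<beta> :: real
  assumes \<rho>: "\<rho> > 0" and \<beta>: "\<beta> > 0"
begin

text \<open>Taylor coefficients of \<lambda>(z) = h(z) / z; those of h'(z) are
  \<open>gcoeff\<close>.\<close>

definition lcoeff :: "nat \<Rightarrow> real" where
  "lcoeff n = (- 1) ^ n * (Gamma \<beta> / (fact n * Gamma (real n * \<rho> + \<beta>)))"

definition gcoeff :: "nat \<Rightarrow> real" where
  "gcoeff n = real (Suc n) * lcoeff n"

text \<open>
  The quotient of Pochhammer symbols times \<open>M powr (- \<rho> * n)\<close> tends to
  \<open>Gamma \<beta> / Gamma (n * \<rho> + \<beta>)\<close> by Gauss's product. The index is shifted to \<open>M = m + 1\<close>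
  because the rescaling factor would be \<open>0\<close> at \<open>M = 0\<close>.
\<close>
definition lapprox :: "nat \<Rightarrow> nat \<Rightarrow> real" where
  "lapprox m n = (real (Suc m) powr - \<rho>) ^ n *
     ((- 1) ^ n / fact n * (pochhammer (real n * \<rho> + \<beta>) (Suc m) / pochhammer \<beta> (Suc m)))"

section \<open>Approximation by Gauss's product\<close>

lemma arg_pos: "real n * \<rho> + \<beta> > 0"
  using \<rho> \<beta> by (intro add_nonneg_pos) auto

lemma Gamma_pos: "Gamma (real n * \<rho> + \<beta>) > 0"
  by (intro Gamma_real_pos arg_pos)

text \<open>Each further Pochhammer factor (n \<rho> + \<beta> + j) / (\<beta> + j) is one
  normalised operator \<rho> z d/dz + \<beta> + j, so \<open>lp_fps_step\<close> applies M times,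
  starting from exp (- z).\<close>

lemma pochhammer_quotient_lp:
  "\<exists>X. finite X \<and> (\<forall>x\<in>X. x > 0) \<and>
     Abs_fps (\<lambda>n. (- 1) ^ n / fact n * (pochhammer (real n * \<rho> + \<beta>) M / pochhammer \<beta> M)) = lp_fps 1 X"
proof (induction M)
  case 0
  have "Abs_fps (\<lambda>n. (- 1) ^ n / fact n * (pochhammer (real n * \<rho> + \<beta>) 0 / pochhammer \<beta> 0)) = lp_fps 1 {}"
    by (rule fps_ext) (simp add: lp_fps_def)
  thus ?case by blast
next
  case (Suc M)
  then obtain X where X: "finite X" "\<forall>x\<in>X. x > 0"
    "Abs_fps (\<lambda>n. (- 1) ^ n / fact n * (pochhammer (real n * \<rho> + \<beta>) M / pochhammer \<beta> M)) = lp_fps 1 X"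
    by blast
  have nth: "lp_fps 1 X $ n = (- 1) ^ n / fact n * (pochhammer (real n * \<rho> + \<beta>) M / pochhammer \<beta> M)" for n
    by (simp flip: X(3))
  have "\<exists>Y. finite Y \<and> (\<forall>y\<in>Y. y > 0) \<and>
      Abs_fps (\<lambda>n. (\<rho> * real n + (\<beta> + real M)) / (\<beta> + real M) * lp_fps 1 X $ n) = lp_fps 1 Y"
    using X \<rho> \<beta> by (intro lp_fps_step) auto
  moreover have "(\<rho> * real n + (\<beta> + real M)) / (\<beta> + real M) * lp_fps 1 X $ n =
      (- 1) ^ n / fact n * (pochhammer (real n * \<rho> + \<beta>) (Suc M) / pochhammer \<beta> (Suc M))" for n
    by (simp add: nth pochhammer_Suc mult_ac add_ac)
  ultimately show ?case by simp
qed

text \<open>Rescaling z multiplies the reciprocal zeros by s. One more \<open>lp_fps_step\<close>,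
  with b = c = 1, is the map from f to (z f)' and gives the approximants of h'.\<close>

lemma lapprox_lp:
  "\<exists>X Y. finite X \<and> (\<forall>x\<in>X. x > 0) \<and> Abs_fps (lapprox m) = lp_fps (real (Suc m) powr - \<rho>) X \<and>
     finite Y \<and> (\<forall>y\<in>Y. y > 0) \<and>
     Abs_fps (\<lambda>n. real (Suc n) * lapprox m n) = lp_fps (real (Suc m) powr - \<rho>) Y"
proof -
  define s where "s = real (Suc m) powr - \<rho>"
  have s: "s > 0" unfolding s_def by (simp del: of_nat_Suc)
  obtain X where X: "finite X" "\<forall>x\<in>X. x > 0"
    "Abs_fps (\<lambda>n. (- 1) ^ n / fact n * (pochhammer (real n * \<rho> + \<beta>) (Suc m) / pochhammer \<beta> (Suc m))) = lp_fps 1 X"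
    using pochhammer_quotient_lp by blast
  have "lapprox m = (\<lambda>n. s ^ n * lp_fps 1 X $ n)"
    by (rule ext) (simp add: lapprox_def s_def flip: X(3))
  hence eq: "Abs_fps (lapprox m) = lp_fps s ((*) s ` X)"
    using lp_fps_scale[OF X(1), of s 1] s by simp
  have "\<exists>Y. finite Y \<and> (\<forall>y\<in>Y. y > 0) \<and>
      Abs_fps (\<lambda>n. (1 * real n + 1) / 1 * lp_fps s ((*) s ` X) $ n) = lp_fps s Y"
    using X s by (intro lp_fps_step) auto
  moreover have "(1 * real n + 1) / 1 * lp_fps s ((*) s ` X) $ n = real (Suc n) * lapprox m n" for n
    by (simp flip: eq)
  ultimately obtain Y where "finite Y" "\<forall>y\<in>Y. y > 0"
    "Abs_fps (\<lambda>n. real (Suc n) * lapprox m n) = lp_fps s Y" by auto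
  with X s eq show ?thesis unfolding s_def[symmetric]
    by (intro exI[of _ "(*) s ` X"] exI[of _ Y]) auto
qed

lemma powr_power: "(real (Suc m) powr - \<rho>) ^ n = exp (- (real n * \<rho> * ln (real (Suc m))))"
  by (simp add: powr_def mult_ac flip: exp_of_nat_mult)

lemma lapprox_tendsto: "(\<lambda>m. lapprox m n) \<longlonglongrightarrow> lcoeff n"
proof -
  let ?x = "real n * \<rho> + \<beta>"
  have eq: "lapprox m n = (- 1) ^ n / fact n * (Gamma_series' \<beta> (Suc m) / Gamma_series' ?x (Suc m))" for m
  proof -
    have "exp (?x * ln (real (Suc m))) = exp (\<beta> * ln (real (Suc m))) * exp (real n * \<rho> * ln (real (Suc m)))"
      by (simp add: algebra_simps flip: exp_add)
    thus ?thesis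
      unfolding lapprox_def powr_power Gamma_series'_def
      by (simp add: exp_minus field_simps)
  qed
  have "(\<lambda>m. (- 1) ^ n / fact n * (Gamma_series' \<beta> (Suc m) / Gamma_series' ?x (Suc m))) \<longlonglongrightarrow>
      (- 1) ^ n / fact n * (Gamma \<beta> / Gamma ?x)"
    using Gamma_pos[of n] by (intro tendsto_intros LIMSEQ_Suc Gamma_series'_LIMSEQ) auto
  thus ?thesis by (simp add: eq lcoeff_def)
qed

definition bound_base :: real where
  "bound_base = exp (\<rho> * (1 / \<beta> + 1))"

text \<open>Each factor 1 + n \<rho> / (\<beta> + i) is at most an exponential, and the sum of the 1
  / (\<beta> + i) is at most 1 / \<beta> + 1 + ln M. The power M^(n \<rho>) cancels against the
  rescaling, which leaves \<open>bound_base ^ n\<close>.\<close>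

lemma lapprox_bound: "\<bar>lapprox m n\<bar> \<le> bound_base ^ n / fact n"
proof -
  let ?M = "Suc m"
  have "(\<Sum>i<?M. 1 / (\<beta> + real i)) = 1 / \<beta> + (\<Sum>i<m. 1 / (\<beta> + real (Suc i)))"
    by (subst sum.lessThan_Suc_shift) simp
  also have "(\<Sum>i<m. 1 / (\<beta> + real (Suc i))) \<le> (\<Sum>i<m. 1 / real (Suc i))"
    using \<beta> by (intro sum_mono divide_left_mono) auto
  also have "\<dots> \<le> (\<Sum>i<?M. 1 / real (Suc i))" by (intro sum_mono2) auto
  also have "\<dots> = harm ?M" by (simp only: harm_def One_nat_def sum.atLeast1_atMost_eq inverse_eq_divide)
  also have "\<dots> \<le> 1 + ln (real ?M)"
    using decseqD[OF decseq_harm_diff_ln, of 0 m] by (simp add: harm_def)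
  finally have sum: "(\<Sum>i<?M. 1 / (\<beta> + real i)) \<le> 1 / \<beta> + 1 + ln (real ?M)" by simp
  have "pochhammer (real n * \<rho> + \<beta>) ?M / pochhammer \<beta> ?M =
      (\<Prod>i<?M. (real n * \<rho> + \<beta> + real i) / (\<beta> + real i))"
    by (simp only: pochhammer_prod prod_dividef atLeast0LessThan)
  also have "\<dots> \<le> (\<Prod>i<?M. exp (real n * \<rho> * (1 / (\<beta> + real i))))"
  proof (intro prod_mono conjI)
    fix i
    have "(real n * \<rho> + \<beta> + real i) / (\<beta> + real i) = 1 + real n * \<rho> * (1 / (\<beta> + real i))"
      using \<beta> by (simp add: field_simps)
    also have "\<dots> \<le> exp (real n * \<rho> * (1 / (\<beta> + real i)))" by (rule exp_ge_add_one_self)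
    finally show "(real n * \<rho> + \<beta> + real i) / (\<beta> + real i) \<le> exp (real n * \<rho> * (1 / (\<beta> + real i)))" .
    show "0 \<le> (real n * \<rho> + \<beta> + real i) / (\<beta> + real i)" using \<rho> \<beta> by simp
  qed
  also have "\<dots> = exp (real n * \<rho> * (\<Sum>i<?M. 1 / (\<beta> + real i)))"
    by (simp only: exp_sum finite_lessThan sum_distrib_left)
  also have "\<dots> \<le> exp (real n * \<rho> * (1 / \<beta> + 1 + ln (real ?M)))"
    using sum \<rho> by (intro iffD2[OF exp_le_cancel_iff] mult_left_mono) auto
  also have "\<dots> = bound_base ^ n * exp (real n * \<rho> * ln (real ?M))"
    by (simp add: bound_base_def algebra_simps flip: exp_of_nat_mult exp_add)
  finally have "pochhammer (real n * \<rho> + \<beta>) ?M / pochhammer \<beta> ?M * exp (- (real n * \<rho> * ln (real ?M)))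
      \<le> bound_base ^ n * exp (real n * \<rho> * ln (real ?M)) * exp (- (real n * \<rho> * ln (real ?M)))"
    by (intro mult_right_mono) auto
  also have "\<dots> = bound_base ^ n" by (simp add: exp_minus)
  finally have le: "exp (- (real n * \<rho> * ln (real ?M))) *
      (pochhammer (real n * \<rho> + \<beta>) ?M / pochhammer \<beta> ?M) \<le> bound_base ^ n" by (simp add: mult_ac)
  have "pochhammer (real n * \<rho> + \<beta>) ?M > 0" "pochhammer \<beta> ?M > 0"
    using arg_pos \<beta> by (auto intro!: pochhammer_pos)
  hence "\<bar>lapprox m n\<bar> = exp (- (real n * \<rho> * ln (real ?M))) *
      (pochhammer (real n * \<rho> + \<beta>) ?M / pochhammer \<beta> ?M) / fact n"
    unfolding lapprox_def powr_power by (simp add: abs_mult)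
  also have "\<dots> \<le> bound_base ^ n / fact n" using le by (intro divide_right_mono) auto
  finally show ?thesis .
qed

lemma summable_power_div_fact: "summable (\<lambda>n. c ^ n / fact n * r ^ n)" for c r :: real
  using summable_exp[of "c * r"] by (simp add: divide_inverse power_mult_distrib mult_ac)

lemma starlike_limit_wright:
  obtains a X Y where
    "starlike_limit lapprox lcoeff (\<lambda>n. bound_base ^ n / fact n) a X
       (\<lambda>m n. real (Suc n) * lapprox m n) gcoeff (\<lambda>n. (2 * bound_base) ^ n / fact n) a Y"
proof -
  let ?P = "\<lambda>m X Y. finite X \<and> (\<forall>x\<in>X. x > 0) \<and>
     Abs_fps (lapprox m) = lp_fps (real (Suc m) powr - \<rho>) X \<and> finite Y \<and> (\<forall>y\<in>Y. y > 0) \<and>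
     Abs_fps (\<lambda>n. real (Suc n) * lapprox m n) = lp_fps (real (Suc m) powr - \<rho>) Y"
  have "\<forall>m. \<exists>X Y. ?P m X Y" using lapprox_lp by blast
  from choice[OF this] obtain X where "\<forall>m. \<exists>Y. ?P m (X m) Y" ..
  from choice[OF this] obtain Y where XY: "\<forall>m. ?P m (X m) (Y m)" ..
  have "starlike_limit lapprox lcoeff (\<lambda>n. bound_base ^ n / fact n) (\<lambda>m. real (Suc m) powr - \<rho>) X
       (\<lambda>m n. real (Suc n) * lapprox m n) gcoeff (\<lambda>n. (2 * bound_base) ^ n / fact n)
       (\<lambda>m. real (Suc m) powr - \<rho>) Y"
  proof unfold_locales
    fix m n
    show "finite (X m)" "finite (Y m)" using XY by auto
    show "Abs_fps (lapprox m) = lp_fps (real (Suc m) powr - \<rho>) (X m)"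
      "Abs_fps (\<lambda>n. real (Suc n) * lapprox m n) = lp_fps (real (Suc m) powr - \<rho>) (Y m)"
      using XY by blast+
    show "x > 0" if "x \<in> X m" for x using XY that by blast
    show "x > 0" if "x \<in> Y m" for x using XY that by blast
    show "real (Suc m) powr - \<rho> > 0" by (simp del: of_nat_Suc)
    show "\<bar>lapprox m n\<bar> \<le> bound_base ^ n / fact n" by (rule lapprox_bound)
    \<comment> \<open>The factor n + 1 produced by differentiation is absorbed by doubling the base
      of the majorant.\<close>
    have "real (Suc n) \<le> real (2 ^ n)" unfolding of_nat_le_iff by (simp add: Suc_leI)
    hence "\<bar>real (Suc n) * lapprox m n\<bar> \<le> 2 ^ n * (bound_base ^ n / fact n)"
      unfolding abs_mult using lapprox_bound[of m n] by (intro mult_mono) auto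
    thus "\<bar>real (Suc n) * lapprox m n\<bar> \<le> (2 * bound_base) ^ n / fact n"
      by (simp add: power_mult_distrib)
    show "summable (\<lambda>n. bound_base ^ n / fact n * r ^ n)"
      "summable (\<lambda>n. (2 * bound_base) ^ n / fact n * r ^ n)" for r :: real
      by (rule summable_power_div_fact)+
    show "(\<lambda>m. lapprox m n) \<longlonglongrightarrow> lcoeff n" by (rule lapprox_tendsto)
    show "(\<lambda>m. real (Suc n) * lapprox m n) \<longlonglongrightarrow> gcoeff n"
      unfolding gcoeff_def by (intro tendsto_intros lapprox_tendsto)
  qed simp
  thus ?thesis by (rule that)
qed

text \<open>With x = n \<rho> + \<beta>, the growth quotient is (n + 1) / (n + 2) times Gamma (x +
  \<rho>) / Gamma x. The first factor is at least 1/2 and the second at least (x - 1)^\<rho>, once n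
  > 1 / \<rho> ensures x > 1.\<close>

lemma gcoeff_not_geometric:
  assumes "t > 0"
  shows "\<exists>k\<ge>2. newton_sum gcoeff (Suc k) * t \<noteq> newton_sum gcoeff k"
proof -
  define d where "d n = real (Suc n) * (Gamma \<beta> / (fact n * Gamma (real n * \<rho> + \<beta>)))" for n
  have "Gamma \<beta> > 0" using \<beta> by (rule Gamma_real_pos)
  have lower: "filterlim (\<lambda>n. (real n * \<rho> + \<beta> - 1) powr \<rho> / 2) at_top sequentially"
    using \<rho> by real_asymp
  have "eventually (\<lambda>n. real n > 1 / \<rho>) sequentially"
    using filterlim_real_sequentially by (simp add: filterlim_at_top_dense)
  hence "eventually (\<lambda>n. (real n * \<rho> + \<beta> - 1) powr \<rho> / 2 \<le> d n / (real (Suc n) * d (Suc n))) sequentially"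
  proof eventually_elim
    case (elim n)
    let ?x = "real n * \<rho> + \<beta>"
    have "?x > 1" using elim \<rho> \<beta> by (simp add: field_simps)
    have x': "real (Suc n) * \<rho> + \<beta> = ?x + \<rho>" by (simp add: algebra_simps)
    have g: "Gamma ?x > 0" "Gamma (?x + \<rho>) > 0"
      using Gamma_pos[of n] Gamma_pos[of "Suc n"] unfolding x' .
    have "(?x - 1) powr \<rho> / 2 \<le> Gamma (?x + \<rho>) / Gamma ?x / 2"
      using Gamma_ratio_ge[OF \<open>?x > 1\<close> \<rho>] g by (simp add: field_simps)
    also have "\<dots> = (1 / 2) * (Gamma (?x + \<rho>) / Gamma ?x)" by simp
    also have "\<dots> \<le> (real (Suc n) / real (n + 2)) * (Gamma (?x + \<rho>) / Gamma ?x)"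
      using g by (intro mult_right_mono) (auto simp: field_simps)
    also have "\<dots> = d n / (real (Suc n) * d (Suc n))"
    proof -
      have "a / b * (u / v) = a * (c / (f * v)) / (a * (b * (c / (a * f * u))))"
        if "a > 0" "b > 0" "c > 0" "f > 0" "u > 0" "v > 0" for a b c f u v :: real
        using that by (simp add: field_simps)
      from this[of "real (Suc n)" "real (n + 2)" "Gamma \<beta>" "fact n" "Gamma (?x + \<rho>)" "Gamma ?x"]
      show ?thesis
        unfolding d_def x' using g \<open>Gamma \<beta> > 0\<close> by (simp add: add_ac)
    qed
    finally show ?case .
  qed
  hence "filterlim (\<lambda>n. d n / (real (Suc n) * d (Suc n))) at_top sequentially"
    by (rule filterlim_at_top_mono[OF lower])
  moreover have "d n > 0" for n
    using Gamma_pos[of n] \<open>Gamma \<beta> > 0\<close> by (simp add: d_def)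
  moreover have "d 0 = 1" using \<open>Gamma \<beta> > 0\<close> by (simp add: d_def)
  ultimately have "\<exists>k\<ge>2. newton_sum (\<lambda>n. (- 1) ^ n * d n) (Suc k) * t \<noteq> newton_sum (\<lambda>n. (- 1) ^ n * d n) k"
    using assms by (intro newton_sum_not_eventually_geometric)
  moreover have "gcoeff = (\<lambda>n. (- 1) ^ n * d n)"
    by (rule ext) (simp add: gcoeff_def lcoeff_def d_def)
  ultimately show ?thesis by simp
qed

section \<open>The radius for the Wright function and its explicit bounds\<close>

lemma wright_h_eq: "wright_h \<rho> \<beta> z = z * pser lcoeff z"
proof -
  obtain a X Y where "starlike_limit lapprox lcoeff (\<lambda>n. bound_base ^ n / fact n) a X
       (\<lambda>m n. real (Suc n) * lapprox m n) gcoeff (\<lambda>n. (2 * bound_base) ^ n / fact n) a Y"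
    by (rule starlike_limit_wright)
  then interpret starlike_limit lapprox lcoeff "\<lambda>n. bound_base ^ n / fact n" a X
       "\<lambda>m n. real (Suc n) * lapprox m n" gcoeff "\<lambda>n. (2 * bound_base) ^ n / fact n" a Y .
  have g: "Gamma \<beta> > 0" using \<beta> by (rule Gamma_real_pos)
  have "(\<lambda>n. inverse (of_real (Gamma \<beta>)) * (of_real (lcoeff n) * z ^ n)) sums
      (inverse (of_real (Gamma \<beta>)) * pser lcoeff z)"
    unfolding pser_def by (intro sums_mult summable_sums L.summable_D)
  moreover have "inverse (of_real (Gamma \<beta>)) * (of_real (lcoeff n) * z ^ n) =
      (- z) ^ n / (fact n * of_real (Gamma (real n * \<rho> + \<beta>)))" for n
    using g by (simp add: lcoeff_def field_simps power_minus')
  ultimately have "wright \<rho> \<beta> (- z) = inverse (of_real (Gamma \<beta>)) * pser lcoeff z"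
    by (simp add: wright_def sums_iff)
  thus ?thesis using g by (simp add: wright_h_def)
qed

lemma radius_bounds:
  obtains \<tau> where "\<tau> > 0" "radius_of_starlikeness (wright_h \<rho> \<beta>) = ereal \<tau>"
    and "newton_sum gcoeff 1 * \<tau> > 1" "newton_sum gcoeff 2 * \<tau>\<^sup>2 > 1"
    and "newton_sum gcoeff 2 * \<tau> < newton_sum gcoeff 1"
    and "newton_sum gcoeff 3 * \<tau> < newton_sum gcoeff 2" "newton_sum gcoeff 3 > 0"
proof -
  obtain a X Y where "starlike_limit lapprox lcoeff (\<lambda>n. bound_base ^ n / fact n) a X
       (\<lambda>m n. real (Suc n) * lapprox m n) gcoeff (\<lambda>n. (2 * bound_base) ^ n / fact n) a Y"
    by (rule starlike_limit_wright)
  then interpret starlike_limit lapprox lcoeff "\<lambda>n. bound_base ^ n / fact n" a X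
       "\<lambda>m n. real (Suc n) * lapprox m n" gcoeff "\<lambda>n. (2 * bound_base) ^ n / fact n" a Y .
  have "gcoeff 2 > 0"
    using Gamma_pos[of 2] Gamma_real_pos[OF \<beta>] by (simp add: gcoeff_def lcoeff_def)
  show ?thesis
  proof (rule G.euler_rayleigh_bounds[OF \<open>gcoeff 2 > 0\<close> gcoeff_not_geometric])
    fix \<tau> :: real
    assume \<tau>: "\<tau> > 0" "pser gcoeff \<tau> = 0" "\<And>r. 0 \<le> r \<Longrightarrow> r < \<tau> \<Longrightarrow> pser gcoeff r > 0"
      and bounds: "newton_sum gcoeff 1 * \<tau> > 1" "newton_sum gcoeff 2 * \<tau>\<^sup>2 > 1"
        "newton_sum gcoeff 2 * \<tau> < newton_sum gcoeff 1"
        "newton_sum gcoeff 3 * \<tau> < newton_sum gcoeff 2" "newton_sum gcoeff 3 > 0"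
    show thesis
      by (rule that[OF \<tau>(1) radius_of_starlikeness_eq[OF \<tau> wright_h_eq] bounds])
  qed
qed

text \<open>Newton's identities applied to the first three coefficients of h'. The expressions with
  parameters (4, 3) and (8, 9) appear on clearing denominators.\<close>

lemma newton_sums:
  shows "newton_sum gcoeff 1 = 2 * Gamma \<beta> / Gamma (\<rho> + \<beta>)"
    and "newton_sum gcoeff 2 =
           Gamma \<beta> * Gamma_Delta 4 3 \<rho> \<beta> / ((Gamma (\<rho> + \<beta>))\<^sup>2 * Gamma (2 * \<rho> + \<beta>))"
    and "newton_sum gcoeff 3 = Gamma \<beta> * (Gamma \<beta> * Gamma (3 * \<rho> + \<beta>) * Gamma_Delta 8 9 \<rho> \<beta>
           + 2 * (Gamma (\<rho> + \<beta>)) ^ 3 * Gamma (2 * \<rho> + \<beta>)) /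
           ((Gamma (\<rho> + \<beta>)) ^ 3 * Gamma (2 * \<rho> + \<beta>) * Gamma (3 * \<rho> + \<beta>))"
proof -
  define g0 g1 g2 g3 where g: "g0 = Gamma \<beta>" "g1 = Gamma (\<rho> + \<beta>)" "g2 = Gamma (2 * \<rho> + \<beta>)"
    "g3 = Gamma (3 * \<rho> + \<beta>)"
  have pos: "g0 > 0" "g1 > 0" "g2 > 0" "g3 > 0"
    using Gamma_pos[of 0] Gamma_pos[of 1] Gamma_pos[of 2] Gamma_pos[of 3] by (simp_all add: g)
  have D0: "gcoeff 0 = 1" using pos by (simp add: gcoeff_def lcoeff_def g)
  have D: "gcoeff 1 = - 2 * g0 / g1" "gcoeff 2 = 3 * g0 / (2 * g2)" "gcoeff 3 = - (2 * g0) / (3 * g3)"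
    by (simp_all add: gcoeff_def lcoeff_def g fact_numeral)
  have s1: "newton_sum gcoeff 1 = 2 * g0 / g1"
    using newton_sum_rec[of gcoeff 0] D0 D by simp
  have s2: "newton_sum gcoeff 2 = - 2 * gcoeff 2 - gcoeff 1 * newton_sum gcoeff 1"
    using newton_sum_rec[of gcoeff 1] D0 by (simp add: numeral_2_eq_2)
  have s3: "newton_sum gcoeff 3 = - 3 * gcoeff 3 - (gcoeff 1 * newton_sum gcoeff 2 + gcoeff 2 * newton_sum gcoeff 1)"
    using newton_sum_rec[of gcoeff 2] D0 by (simp add: numeral_2_eq_2 numeral_3_eq_3)
  show "newton_sum gcoeff 1 = 2 * Gamma \<beta> / Gamma (\<rho> + \<beta>)" by (simp only: s1 g)
  have s2': "newton_sum gcoeff 2 = g0 * (4 * g0 * g2 - 3 * g1\<^sup>2) / (g1\<^sup>2 * g2)"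
    unfolding s2 s1 D using pos by (simp add: field_simps power2_eq_square)
  thus "newton_sum gcoeff 2 =
      Gamma \<beta> * Gamma_Delta 4 3 \<rho> \<beta> / ((Gamma (\<rho> + \<beta>))\<^sup>2 * Gamma (2 * \<rho> + \<beta>))"
    by (simp only: g Gamma_Delta_def)
  have "newton_sum gcoeff 3 = g0 * (g0 * g3 * (8 * g0 * g2 - 9 * g1\<^sup>2) + 2 * g1 ^ 3 * g2) / (g1 ^ 3 * g2 * g3)"
    unfolding s3 s2' s1 D using pos by (simp add: field_simps power2_eq_square power3_eq_cube)
  thus "newton_sum gcoeff 3 = Gamma \<beta> * (Gamma \<beta> * Gamma (3 * \<rho> + \<beta>) * Gamma_Delta 8 9 \<rho> \<beta>
           + 2 * (Gamma (\<rho> + \<beta>)) ^ 3 * Gamma (2 * \<rho> + \<beta>)) /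
           ((Gamma (\<rho> + \<beta>)) ^ 3 * Gamma (2 * \<rho> + \<beta>) * Gamma (3 * \<rho> + \<beta>))"
    by (simp only: g Gamma_Delta_def)
qed

end

theorem theorem4:
  fixes \<rho> \<beta> :: real
  assumes "\<rho> > 0" and "\<beta> > 0"
  shows "ereal (Gamma (\<rho> + \<beta>) / (2 * Gamma \<beta>))
           < radius_of_starlikeness (wright_h \<rho> \<beta>)
       \<and> radius_of_starlikeness (wright_h \<rho> \<beta>)
           < ereal (2 * Gamma (\<rho> + \<beta>) * Gamma (2 * \<rho> + \<beta>) / Gamma_Delta 4 3 \<rho> \<beta>)
       \<and> ereal (sqrt ((Gamma (\<rho> + \<beta>))\<^sup>2 * Gamma (2 * \<rho> + \<beta>) / (Gamma \<beta> * Gamma_Delta 4 3 \<rho> \<beta>)))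
           < radius_of_starlikeness (wright_h \<rho> \<beta>)
       \<and> radius_of_starlikeness (wright_h \<rho> \<beta>)
           < ereal (Gamma (\<rho> + \<beta>) * Gamma (3 * \<rho> + \<beta>) * Gamma_Delta 4 3 \<rho> \<beta>
               / (Gamma \<beta> * Gamma (3 * \<rho> + \<beta>) * Gamma_Delta 8 9 \<rho> \<beta>
                    + 2 * (Gamma (\<rho> + \<beta>)) ^ 3 * Gamma (2 * \<rho> + \<beta>)))"
proof -
  interpret wright_parameters \<rho> \<beta> by unfold_locales (fact assms)+
  obtain \<tau> where \<tau>: "\<tau> > 0" "radius_of_starlikeness (wright_h \<rho> \<beta>) = ereal \<tau>"
    and b: "newton_sum gcoeff 1 * \<tau> > 1" "newton_sum gcoeff 2 * \<tau>\<^sup>2 > 1"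
    "newton_sum gcoeff 2 * \<tau> < newton_sum gcoeff 1"
    "newton_sum gcoeff 3 * \<tau> < newton_sum gcoeff 2" "newton_sum gcoeff 3 > 0"
    by (rule radius_bounds)
  define g0 g1 g2 g3 where g: "g0 = Gamma \<beta>" "g1 = Gamma (\<rho> + \<beta>)" "g2 = Gamma (2 * \<rho> + \<beta>)"
    "g3 = Gamma (3 * \<rho> + \<beta>)"
  define P where "P = Gamma_Delta 4 3 \<rho> \<beta>"
  define Q where "Q = g0 * g3 * Gamma_Delta 8 9 \<rho> \<beta> + 2 * g1 ^ 3 * g2"
  have pos: "g0 > 0" "g1 > 0" "g2 > 0" "g3 > 0"
    using Gamma_pos[of 0] Gamma_pos[of 1] Gamma_pos[of 2] Gamma_pos[of 3] by (simp_all add: g)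
  have s: "newton_sum gcoeff 1 = 2 * g0 / g1" "newton_sum gcoeff 2 = g0 * P / (g1\<^sup>2 * g2)"
    "newton_sum gcoeff 3 = g0 * Q / (g1 ^ 3 * g2 * g3)"
    unfolding newton_sums by (simp_all only: g P_def Q_def)
  \<comment> \<open>Positivity of both denominators P and Q is read off from that of the second and
    third power sums.\<close>
  have "newton_sum gcoeff 2 * \<tau>\<^sup>2 > 0" using b(2) by linarith
  hence s2_pos: "newton_sum gcoeff 2 > 0" using \<tau> by (simp add: zero_less_mult_iff)
  hence P: "P > 0" using pos unfolding s by (auto simp: zero_less_divide_iff zero_less_mult_iff mult_less_0_iff)
  have Q: "Q > 0" using b(5) pos unfolding s by (auto simp: zero_less_divide_iff zero_less_mult_iff mult_less_0_iff)
  \<comment> \<open>The four bounds are, in order, s_1 \<tau> > 1, s_2 \<tau> < s_1, s_2 \<tau>^2 >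
    1 and s_3 \<tau> < s_2 solved for \<tau>.\<close>
  have "g1 / (2 * g0) < \<tau>" using b(1) pos unfolding s by (simp add: field_simps)
  moreover have "\<tau> < 2 * g1 * g2 / P"
    using b(3) pos P unfolding s by (simp add: field_simps power2_eq_square)
  moreover have "sqrt (g1\<^sup>2 * g2 / (g0 * P)) < \<tau>"
    using b(2) pos P \<tau>(1) unfolding s by (intro real_less_lsqrt) (auto simp: field_simps)
  moreover have "\<tau> < g1 * g3 * P / Q"
    using b(4) pos Q unfolding s by (simp add: field_simps power2_eq_square power3_eq_cube)
  ultimately show ?thesis
    unfolding \<tau>(2) g P_def Q_def by simp
qed

end
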